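(* Let $\Gamma=\langle S\mid R\rangle$ be a finitely presented group and let $\varphi_n\colon S\to\mathrm U(k_n)$ be an asymptotic representation with respect to a family of submultiplicative, unitarily invariant norms. Assume that the associated $2$-cocycle $\alpha$ (described in the context) is trivial in $H^2(\Gamma,\mathrm M_{\mathcal U})$, i.e. there is $\beta\colon\Gamma\to\mathrm M_{\mathcal U}$ with $\alpha(g,h)=\varphi_{\mathcal U}(g)\beta(h)\varphi_{\mathcal U}(g)^*-\beta(gh)+\beta(g)$ for all $g,h\in\Gamma$. Then there exists an asymptotic representation $\varphi_n'\colon S\to\mathrm U(k_n)$ such that (i) $\max_{s\in S}\|\varphi_n(s)-\varphi_n'(s)\|=O_{\mathcal U}(\mathrm{def}(\varphi_n))$ and (ii) $\mathrm{def}(\varphi_n')=o_{\mathcal U}(\mathrm{def}(\varphi_n))$.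
   Context: Fix a non-principal ultrafilter $\mathcal U$ on $\mathbb N$; $x_n=O_{\mathcal U}(y_n)$ means $x_n\le Cy_n$ for all $n$ in a set belonging to $\mathcal U$, some constant $C$; $x_n=o_{\mathcal U}(y_n)$ means $x_n=\varepsilon_ny_n$ with $\varepsilon_n\ge0$, $\lim_{n\to\mathcal U}\varepsilon_n=0$. $S,R$ are finite, $\mathbb F_S$ is free on $S$. For each $k$ a norm $\|\cdot\|$ on $\mathrm M_k(\mathbb C)$ is fixed which is unitarily invariant ($\|UAV\|=\|A\|$ for unitaries $U,V$) and submultiplicative. For $\varphi\colon S\to\mathrm U(k)$ (extended to $\mathbb F_S$), $\mathrm{def}(\varphi)=\max_{r\in R}\|\varphi(r)-1_k\|$; a sequence $\varphi_n\colon S\to\mathrm U(k_n)$ is an asymptotic representation if $\lim_{n\to\mathcal U}\mathrm{def}(\varphi_n)=0$. $\mathrm M_{\mathcal U}$ is the Banach space of bounded sequences $(T_n)$, $T_n\in\mathrm M_{k_n}(\mathbb C)$, modulo those with $\lim_{n\to\mathcal U}\|T_n\|=0$; $\mathrm U_{\mathcal U}$ is $\prod_n\mathrm U(k_n)$ modulo sequences with $\lim_{n\to\mathcal U}\|u_n-1\|=0$, acting on $\mathrm M_{\mathcal U}$ by left/right multiplication; $\varphi_{\mathcal U}\colon\Gamma\to\mathrm U_{\mathcal U}$ is the induced homomorphism ($g\mapsto$ class of $(\varphi_n(w))_n$, $w$ a word representing $g$), and $\Gamma$ acts on $\mathrm M_{\mathcal U}$ by $T\mapsto\varphi_{\mathcal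 U}(g)T\varphi_{\mathcal U}(g)^*$. The associated cocycle: fix a section $\sigma\colon\Gamma\to\mathbb F_S$ of the canonical surjection and $\tilde\varphi_n\colon\Gamma\to\mathrm U(k_n)$ with $\tilde\varphi_n(1_\Gamma)=1$, $\tilde\varphi_n(g^{-1})=\tilde\varphi_n(g)^*$, $\|\varphi_n(\sigma(g))-\tilde\varphi_n(g)\|=O_{\mathcal U}(\mathrm{def}(\varphi_n))$; let $c_n(g,h)=(\tilde\varphi_n(g)\tilde\varphi_n(h)-\tilde\varphi_n(gh))/\mathrm{def}(\varphi_n)$ if $\mathrm{def}(\varphi_n)>0$, else $0$, $c(g,h)\in\mathrm M_{\mathcal U}$ its class, and $\alpha(g,h)=c(g,h)\varphi_{\mathcal U}(gh)^*$. *)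

theory Defs
  imports "Jordan_Normal_Form.Schur_Decomposition"
begin

definition nonprincipal_ultrafilter :: "nat filter \<Rightarrow> bool" where
  "nonprincipal_ultrafilter U \<longleftrightarrow>
     U \<noteq> bot \<and>
     (\<forall>P. eventually P U \<or> eventually (\<lambda>n. \<not> P n) U) \<and>
     (\<forall>m. eventually (\<lambda>n. n \<noteq> m) U)"

definition bigO_U :: "nat filter \<Rightarrow> (nat \<Rightarrow> real) \<Rightarrow> (nat \<Rightarrow> real) \<Rightarrow> bool" where
  "bigO_U U x y \<longleftrightarrow> (\<exists>C. eventually (\<lambda>n. x n \<le> C * y n) U)"

definition littleo_U :: "nat filter \<Rightarrow> (nat \<Rightarrow> real) \<Rightarrow> (nat \<Rightarrow> real) \<Rightarrow> bool" where
  "littleo_U U x y \<longleftrightarrow>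
     (\<exists>eps. (\<forall>n. eps n \<ge> 0) \<and> (eps \<longlongrightarrow> 0) U \<and> (\<forall>n. x n = eps n * y n))"

definition unitary_mat :: "nat \<Rightarrow> complex mat \<Rightarrow> bool" where
  "unitary_mat k A \<longleftrightarrow> A \<in> carrier_mat k k \<and>
     A * mat_adjoint A = 1\<^sub>m k \<and> mat_adjoint A * A = 1\<^sub>m k"

definition admissible_norm :: "(complex mat \<Rightarrow> real) \<Rightarrow> bool" where
  "admissible_norm nrm \<longleftrightarrow> (\<forall>k.
     (\<forall>A \<in> carrier_mat k k. nrm A \<ge> 0 \<and> (nrm A = 0 \<longleftrightarrow> A = 0\<^sub>m k k)) \<and>
     (\<forall>A \<in> carrier_mat k k. \<forall>c. nrm (c \<cdot>\<^sub>m A) = cmod c * nrm A) \<and>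
     (\<forall>A \<in> carrier_mat k k. \<forall>B \<in> carrier_mat k k. nrm (A + B) \<le> nrm A + nrm B) \<and>
     (\<forall>A \<in> carrier_mat k k. \<forall>B \<in> carrier_mat k k. nrm (A * B) \<le> nrm A * nrm B) \<and>
     (\<forall>A \<in> carrier_mat k k. \<forall>V W. unitary_mat k V \<longrightarrow> unitary_mat k W \<longrightarrow>
         nrm (V * A * W) = nrm A))"

text \<open>A word in F_S is a list of letters (s, True) = s and (s, False) = s^{-1}.\<close>
type_synonym 's word = "('s \<times> bool) list"

definition inv_word :: "'s word \<Rightarrow> 's word" where
  "inv_word w = rev (map (\<lambda>(s, b). (s, \<not> b)) w)"

definition eval_word :: "nat \<Rightarrow> ('s \<Rightarrow> complex mat) \<Rightarrow> 's word \<Rightarrow> complex mat" where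
  "eval_word k f w =
     foldr (\<lambda>(s, b) M. (if b then f s else mat_adjoint (f s)) * M) w (1\<^sub>m k)"

inductive pres_eq :: "'s word set \<Rightarrow> 's word \<Rightarrow> 's word \<Rightarrow> bool" for R where
  refl: "pres_eq R w w"
| sym: "pres_eq R w v \<Longrightarrow> pres_eq R v w"
| trans: "pres_eq R u v \<Longrightarrow> pres_eq R v w \<Longrightarrow> pres_eq R u w"
| cancel: "pres_eq R (u @ [(s, b), (s, \<not> b)] @ v) (u @ v)"
| relator: "r \<in> R \<Longrightarrow> pres_eq R (u @ r @ v) (u @ v)"

definition cls :: "'s word set \<Rightarrow> 's word \<Rightarrow> 's word set" where
  "cls R w = {v. pres_eq R w v}"

definition Gamma :: "'s word set \<Rightarrow> 's word set set" where
  "Gamma R = range (cls R)"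

definition gmul :: "'s word set \<Rightarrow> 's word set \<Rightarrow> 's word set \<Rightarrow> 's word set" where
  "gmul R g h = cls R ((SOME w. w \<in> g) @ (SOME v. v \<in> h))"

definition ginv :: "'s word set \<Rightarrow> 's word set \<Rightarrow> 's word set" where
  "ginv R g = cls R (inv_word (SOME w. w \<in> g))"

definition gunit :: "'s word set \<Rightarrow> 's word set" where
  "gunit R = cls R []"

text \<open>def(\<phi>) = max_{r \<in> R} \<parallel>\<phi>(r) - 1\<parallel> (taken to be 0 if R is empty).\<close>
definition defect :: "(complex mat \<Rightarrow> real) \<Rightarrow> 's word set \<Rightarrow> nat \<Rightarrow> ('s \<Rightarrow> complex mat) \<Rightarrow> real" where
  "defect nrm R k f = Max (insert 0 ((\<lambda>r. nrm (eval_word k f r - 1\<^sub>m k)) ` R))"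

text \<open>Representative sequence of c(g,h), given the lifts psi_n = tilde phi_n.\<close>
definition cocyc_c ::
  "(complex mat \<Rightarrow> real) \<Rightarrow> 's word set \<Rightarrow> (nat \<Rightarrow> nat) \<Rightarrow> (nat \<Rightarrow> 's \<Rightarrow> complex mat)
   \<Rightarrow> (nat \<Rightarrow> 's word set \<Rightarrow> complex mat) \<Rightarrow> 's word set \<Rightarrow> 's word set \<Rightarrow> nat \<Rightarrow> complex mat" where
  "cocyc_c nrm R k phi psi g h n =
     (let d = defect nrm R (k n) (phi n) in
      if d > 0 then (1 / complex_of_real d) \<cdot>\<^sub>m (psi n g * psi n h - psi n (gmul R g h))
      else 0\<^sub>m (k n) (k n))"

text \<open>Representative sequence of alpha(g,h) = c(g,h) phi_U(gh)^*, where phi_U(x) is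
  represented by (phi_n(sigma x))_n.\<close>
definition cocyc_alpha ::
  "(complex mat \<Rightarrow> real) \<Rightarrow> 's word set \<Rightarrow> (nat \<Rightarrow> nat) \<Rightarrow> (nat \<Rightarrow> 's \<Rightarrow> complex mat)
   \<Rightarrow> ('s word set \<Rightarrow> 's word) \<Rightarrow> (nat \<Rightarrow> 's word set \<Rightarrow> complex mat)
   \<Rightarrow> 's word set \<Rightarrow> 's word set \<Rightarrow> nat \<Rightarrow> complex mat" where
  "cocyc_alpha nrm R k phi sigma psi g h n =
     cocyc_c nrm R k phi psi g h n * mat_adjoint (eval_word (k n) (phi n) (sigma (gmul R g h)))"

end

theory Submission
  imports Defs "Jordan_Normal_Form.Spectral_Radius"
begin

text \<open>Write \<open>d\<close> for the defect. Since the lifts \<open>\<psi>(g)\<close> are unitary, \<open>\<psi>(g) \<psi>(h) \<psi>(gh)\<^sup>* - 1\<close> is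
  skew-adjoint up to \<open>O(d\<^sup>2)\<close>, so the cochain \<open>\<beta>\<close> may be replaced by its skew-adjoint part \<open>B\<close>.
  Choosing unitaries \<open>C(g) = 1 - d B(g) + O(d\<^sup>2)\<close>, the cocycle identity makes \<open>g \<mapsto> C(g) \<psi>(g)\<close>
  multiplicative up to \<open>o(d)\<close>; its restriction to the generators is the improved asymptotic
  representation, since every relator is a word that represents \<open>1\<close>.\<close>

subsection \<open>Adjoints and unitary matrices\<close>

text \<open>The sign and shape of the correction come from a first-order computation. The obstacle
  is that \<open>1 - d \<beta>(g)\<close> is close to a unitary only if \<open>\<beta>(g)\<close> is
  close to skew-adjoint. Taking skew parts respects the equation, being real-linear and compatible
  with conjugation, but to control its size the norm of an adjoint must equal the norm of the
  matrix. That is not among the norm axioms; it follows from the singular value decomposition, which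
  explains the linear algebra below. The dimensions \<open>k n\<close> may grow, and with them the
  norm of the identity, so unitary factors are removed by invariance and never by
  submultiplicativity. Bounds may depend on the group element: finitely many relators meet only
  finitely many elements.\<close>

declare minus_carrier_mat [simp]

lemma mat_adjoint_carrier [simp]:
  "A \<in> carrier_mat n m \<Longrightarrow> mat_adjoint A \<in> carrier_mat m n"
  unfolding mat_adjoint_def by (auto simp: mat_of_rows_def)

lemma dim_mat_adjoint [simp]:
  "dim_row (mat_adjoint A) = dim_col A" "dim_col (mat_adjoint A) = dim_row A"
  unfolding mat_adjoint_def by (auto simp: mat_of_rows_def)

lemma index_mat_adjoint [simp]:
  "i < dim_col A \<Longrightarrow> j < dim_row A \<Longrightarrow> mat_adjoint A $$ (i, j) = conjugate (A $$ (j, i))"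
  unfolding mat_adjoint_def by (auto simp: mat_of_rows_def)

lemma mat_adjoint_adjoint [simp]: "mat_adjoint (mat_adjoint A) = A"
  by (rule eq_matI) auto

lemma mat_adjoint_add:
  "A \<in> carrier_mat n m \<Longrightarrow> B \<in> carrier_mat n m \<Longrightarrow>
    mat_adjoint (A + B) = mat_adjoint A + mat_adjoint B"
  by (rule eq_matI) (auto simp: conjugate_dist_add)

lemma mat_adjoint_minus:
  fixes A B :: "complex mat"
  shows "A \<in> carrier_mat n m \<Longrightarrow> B \<in> carrier_mat n m \<Longrightarrow>
    mat_adjoint (A - B) = mat_adjoint A - mat_adjoint B"
  by (rule eq_matI) auto

lemma mat_adjoint_smult:
  fixes A :: "complex mat"
  shows "mat_adjoint (c \<cdot>\<^sub>m A) = cnj c \<cdot>\<^sub>m mat_adjoint A"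
  by (rule eq_matI) auto

lemma mat_adjoint_one [simp]: "mat_adjoint (1\<^sub>m n :: complex mat) = 1\<^sub>m n"
  by (rule eq_matI) auto

lemma mat_adjoint_mult:
  fixes A B :: "complex mat"
  assumes "A \<in> carrier_mat n m" "B \<in> carrier_mat m l"
  shows "mat_adjoint (A * B) = mat_adjoint B * mat_adjoint A"
  using assms
  by (intro eq_matI) (auto simp: scalar_prod_def mult.commute intro!: sum.cong)

lemma square_mat_mult_carrier [simp]:
  "A \<in> carrier_mat n n \<Longrightarrow> B \<in> carrier_mat n n \<Longrightarrow> A * B \<in> carrier_mat n n"
  by (rule mult_carrier_mat)

lemma mat_adjoint_square_mult:
  fixes A B :: "complex mat"
  shows "A \<in> carrier_mat n n \<Longrightarrow> B \<in> carrier_mat n n \<Longrightarrow>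
    mat_adjoint (A * B) = mat_adjoint B * mat_adjoint A"
  by (rule mat_adjoint_mult)

lemma square_mat_one_mult [simp]:
  fixes A :: "'a::semiring_1 mat"
  shows
  "A \<in> carrier_mat n n \<Longrightarrow> 1\<^sub>m n * A = A"
  "A \<in> carrier_mat n n \<Longrightarrow> A * 1\<^sub>m n = A"
  by (simp_all add: left_mult_one_mat[of A n n] right_mult_one_mat[of A n n])

lemmas square_mat_assoc = assoc_mult_mat[of _ n n _ n _ n for n]

lemma square_mat_cancel_left:
  fixes A :: "'a::semiring_1 mat"
  assumes "A * B = 1\<^sub>m n" "A \<in> carrier_mat n n" "B \<in> carrier_mat n n" "X \<in> carrier_mat n n"
  shows "A * (B * X) = X"
  using assms by (simp add: square_mat_assoc[symmetric])

lemma mat_adjoint_mult_vec: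
  fixes A :: "complex mat"
  assumes A: "A \<in> carrier_mat n m" and v: "v \<in> carrier_vec m" and w: "w \<in> carrier_vec n"
  shows "(A *\<^sub>v v) \<bullet>c w = v \<bullet>c (mat_adjoint A *\<^sub>v w)"
proof -
  have "(A *\<^sub>v v) \<bullet>c w = (\<Sum>i<n. \<Sum>j<m. A $$ (i,j) * v $ j * cnj (w $ i))"
    using A v w by (simp add: scalar_prod_def sum_distrib_right atLeast0LessThan)
  also have "\<dots> = (\<Sum>j<m. \<Sum>i<n. A $$ (i,j) * v $ j * cnj (w $ i))"
    by (rule sum.swap)
  also have "\<dots> = v \<bullet>c (mat_adjoint A *\<^sub>v w)"
    using A v w
    by (simp add: scalar_prod_def sum_distrib_left atLeast0LessThan mult_ac)
  finally show ?thesis .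
qed

lemma unitary_matD:
  assumes "unitary_mat k A"
  shows "A \<in> carrier_mat k k" "A * mat_adjoint A = 1\<^sub>m k" "mat_adjoint A * A = 1\<^sub>m k"
  using assms by (auto simp: unitary_mat_def)

lemma unitary_matI:
  assumes "A \<in> carrier_mat k k" "mat_adjoint A * A = 1\<^sub>m k"
  shows "unitary_mat k A"
  using assms mat_mult_left_right_inverse[of "mat_adjoint A" k A]
  by (auto simp: unitary_mat_def)

lemma unitary_mat_one [simp]: "unitary_mat k (1\<^sub>m k)"
  by (rule unitary_matI) auto

lemma unitary_mat_adjoint [simp]: "unitary_mat k A \<Longrightarrow> unitary_mat k (mat_adjoint A)"
  by (auto simp: unitary_mat_def)

lemma unitary_mat_mult [simp]:
  assumes A: "unitary_mat k A" and B: "unitary_mat k B"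
  shows "unitary_mat k (A * B)"
proof (rule unitary_matI)
  note a = unitary_matD[OF A] and b = unitary_matD[OF B]
  show "A * B \<in> carrier_mat k k" using a b by simp
  show "mat_adjoint (A * B) * (A * B) = 1\<^sub>m k"
    using a b square_mat_cancel_left[of "mat_adjoint A" A k B]
    by (simp add: mat_adjoint_square_mult[of _ k] square_mat_assoc[of _ k])
qed

subsection \<open>Singular value decomposition\<close>

text \<open>Gram-Schmidt leaves the first vector of a basis alone, so a basis completing
  \<open>v\<close> becomes an orthogonal one that still starts with \<open>v\<close>. This turns a
  singular vector into a unitary change of coordinates.\<close>

lemma ex_unitary_col_0:
  fixes v :: "complex vec"
  assumes v: "v \<in> carrier_vec n" and v1: "v \<bullet>c v = 1"
  shows "\<exists>W. unitary_mat n W \<and> col W 0 = v"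
proof -
  have v0: "v \<noteq> 0\<^sub>v n" using v1 by auto
  have n: "n > 0" using v0 v by (cases n) auto
  interpret cof_vec_space n "TYPE(complex)" .
  define b where "b = basis_completion v"
  define ws where "ws = gram_schmidt n b"
  from basis_completion[OF v v0, folded b_def]
  have dist_b: "distinct b" and indep: "\<not> lin_dep (set b)" and b: "set b \<subseteq> carrier_vec n"
    and hdb: "hd b = v" and len_b: "length b = n" by auto
  from hdb len_b n obtain vs where bv: "b = v # vs" by (cases b) auto
  from gram_schmidt_result[OF b dist_b indep HOL.refl, folded ws_def]
  have ws: "set ws \<subseteq> carrier_vec n" "corthogonal ws" "length ws = n"
    by (auto simp: len_b)
  from gram_schmidt_hd[OF v, of vs, folded bv] have hdws: "hd ws = v" unfolding ws_def .
  \<comment> \<open>The vectors are orthogonal but of arbitrary length, hence the rescaling; the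
    factor at index 0 is 1 because \<open>v\<close> is a unit vector.\<close>
  define c where "c i = complex_of_real (1 / sqrt (Re (ws ! i \<bullet>c ws ! i)))" for i
  define W where "W = mat n n (\<lambda>(i, j). c j * ws ! j $ i)"
  have W: "W \<in> carrier_mat n n" by (simp add: W_def)
  have cnj_c: "cnj (c i) = c i" for i by (simp add: c_def)
  have wsi: "ws ! i \<in> carrier_vec n" if "i < n" for i using ws that by auto
  have pos: "ws ! i \<bullet>c ws ! i = complex_of_real (Re (ws ! i \<bullet>c ws ! i))"
            "Re (ws ! i \<bullet>c ws ! i) > 0" if "i < n" for i
  proof -
    have "ws ! i \<bullet>c ws ! i \<noteq> 0" using corthogonalD[OF ws(2)] ws(3) that by auto
    moreover have "ws ! i \<bullet>c ws ! i \<ge> 0" by (rule conjugate_square_ge_0_vec)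
    ultimately show "ws ! i \<bullet>c ws ! i = complex_of_real (Re (ws ! i \<bullet>c ws ! i))"
            "Re (ws ! i \<bullet>c ws ! i) > 0"
      by (auto simp: less_eq_complex_def complex_eq_iff)
  qed
  have "mat_adjoint W * W = 1\<^sub>m n"
  proof (rule eq_matI)
    fix i j assume ij: "i < dim_row (1\<^sub>m n :: complex mat)" "j < dim_col (1\<^sub>m n :: complex mat)"
    have "(mat_adjoint W * W) $$ (i, j) = (\<Sum>l<n. cnj (c i * ws ! i $ l) * (c j * ws ! j $ l))"
      using ij W by (simp add: scalar_prod_def W_def atLeast0LessThan)
    also have "\<dots> = c i * c j * (ws ! j \<bullet>c ws ! i)"
      using ij wsi[of i] wsi[of j]
      by (simp add: scalar_prod_def sum_distrib_left atLeast0LessThan mult_ac cnj_c)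
    also have "\<dots> = 1\<^sub>m n $$ (i, j)"
    proof (cases "i = j")
      case True
      define x where "x = Re (ws ! i \<bullet>c ws ! i)"
      have x: "ws ! i \<bullet>c ws ! i = complex_of_real x" "x > 0" "c i = complex_of_real (1 / sqrt x)"
        using pos[of i] ij unfolding x_def c_def by auto
      have "c i * c i * complex_of_real x = 1"
        using x(2) by (simp add: x(3) flip: of_real_mult)
      then show ?thesis using True ij x(1) by simp
    next
      case False
      then show ?thesis using ij corthogonalD[OF ws(2), of j i] ws(3) by auto
    qed
    finally show "(mat_adjoint W * W) $$ (i, j) = 1\<^sub>m n $$ (i, j)" .
  qed (use W in auto)
  moreover have "col W 0 = v"
  proof (rule eq_vecI)
    have ws0: "ws ! 0 = v" using hdws ws(3) n by (cases ws) auto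
    fix i assume "i < dim_vec v"
    then show "col W 0 $ i = v $ i" using v v1 n by (simp add: W_def c_def ws0)
  qed (use W v in auto)
  ultimately show ?thesis using W unitary_matI by blast
qed

lemma ex_scaled_unit_vec:
  fixes v :: "complex vec"
  assumes v: "v \<in> carrier_vec n" "v \<noteq> 0\<^sub>v n"
  shows "\<exists>c. (c \<cdot>\<^sub>v v) \<bullet>c (c \<cdot>\<^sub>v v) = 1"
proof -
  have "v \<bullet>c v \<noteq> 0" using conjugate_square_eq_0_vec[OF v(1)] v(2) by auto
  moreover have "v \<bullet>c v \<ge> 0" by (rule conjugate_square_ge_0_vec)
  ultimately have r: "v \<bullet>c v = complex_of_real (Re (v \<bullet>c v))" "Re (v \<bullet>c v) > 0"
    by (auto simp: less_eq_complex_def complex_eq_iff)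
  define x where "x = Re (v \<bullet>c v)"
  let ?c = "complex_of_real (1 / sqrt x)"
  have "(?c \<cdot>\<^sub>v v) \<bullet>c (?c \<cdot>\<^sub>v v) = ?c * ?c * (v \<bullet>c v)"
    using v by (simp add: conjugate_smult_vec)
  also have "\<dots> = 1" using r by (simp add: x_def[symmetric] flip: of_real_mult)
  finally show ?thesis by blast
qed

text \<open>\<open>v\<close> is a unit eigenvector of \<open>A^* A\<close>, and \<open>u\<close> is
  \<open>A v\<close> rescaled. The pair need not belong to the largest singular value: the two
  equations alone allow it to be split off.\<close>

lemma ex_singular_pair:
  fixes A :: "complex mat"
  assumes A: "A \<in> carrier_mat n n" and n: "n > 0"
  shows "\<exists>u v. \<exists>s::real. u \<in> carrier_vec n \<and> v \<in> carrier_vec n \<and> u \<bullet>c u = 1 \<and> v \<bullet>c v = 1 \<and>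
    A *\<^sub>v v = complex_of_real s \<cdot>\<^sub>v u \<and> mat_adjoint A *\<^sub>v u = complex_of_real s \<cdot>\<^sub>v v"
proof -
  have A': "mat_adjoint A \<in> carrier_mat n n" using A by simp
  have H: "mat_adjoint A * A \<in> carrier_mat n n" using A by simp
  obtain l where "eigenvalue (mat_adjoint A * A) l"
    using spectrum_non_empty[OF H n] by (auto simp: spectrum_def)
  then obtain v0 where v0: "v0 \<in> carrier_vec n" "v0 \<noteq> 0\<^sub>v n"
    "(mat_adjoint A * A) *\<^sub>v v0 = l \<cdot>\<^sub>v v0"
    using H by (auto simp: eigenvalue_def eigenvector_def)
  obtain c where c: "(c \<cdot>\<^sub>v v0) \<bullet>c (c \<cdot>\<^sub>v v0) = 1" using ex_scaled_unit_vec[OF v0(1,2)] by blast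
  define v where "v = c \<cdot>\<^sub>v v0"
  have v: "v \<in> carrier_vec n" "v \<bullet>c v = 1" using v0 c by (auto simp: v_def)
  have ev: "mat_adjoint A *\<^sub>v (A *\<^sub>v v) = l \<cdot>\<^sub>v v"
  proof -
    have "mat_adjoint A *\<^sub>v (A *\<^sub>v v) = (mat_adjoint A * A) *\<^sub>v v"
      using A A' v by (intro assoc_mult_mat_vec[symmetric]) auto
    also have "\<dots> = c \<cdot>\<^sub>v ((mat_adjoint A * A) *\<^sub>v v0)"
      unfolding v_def by (rule mult_mat_vec[OF H v0(1)])
    finally show ?thesis using v0 by (simp add: v_def smult_smult_assoc mult.commute)
  qed
  have Av: "A *\<^sub>v v \<in> carrier_vec n" using A v by simp
  have nAv: "(A *\<^sub>v v) \<bullet>c (A *\<^sub>v v) = cnj l"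
    using mat_adjoint_mult_vec[OF A v(1) Av] v by (simp add: ev conjugate_smult_vec)
  show ?thesis
  proof (cases "A *\<^sub>v v = 0\<^sub>v n")
    \<comment> \<open>Here \<open>s = 0\<close> and \<open>A v\<close> cannot be normalised. A
      matrix and its adjoint are singular together, so \<open>u\<close> is taken from the kernel of
      the adjoint instead.\<close>
    case True
    have "v \<noteq> 0\<^sub>v n" using v by auto
    then have "det A = 0" using True det_0_iff_vec_prod_zero[OF A] v by auto
    have "det (mat_adjoint A) = 0"
    proof (rule ccontr)
      assume "det (mat_adjoint A) \<noteq> 0"
      then obtain B where B: "B \<in> carrier_mat n n" "mat_adjoint A * B = 1\<^sub>m n"
        using det_non_zero_imp_unit[OF A'] by (auto simp: Units_def ring_mat_def)
      have "mat_adjoint B * A = 1\<^sub>m n"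
        using arg_cong[OF B(2), of mat_adjoint] mat_adjoint_mult[OF A' B(1)] by simp
      then have "det (mat_adjoint B) * det A = 1"
        using det_mult[of "mat_adjoint B" n A] A B by simp
      then show False using \<open>det A = 0\<close> by simp
    qed
    then obtain u0 where u0: "u0 \<in> carrier_vec n" "u0 \<noteq> 0\<^sub>v n" "mat_adjoint A *\<^sub>v u0 = 0\<^sub>v n"
      using det_0_iff_vec_prod_zero[OF A'] by auto
    obtain b where b: "(b \<cdot>\<^sub>v u0) \<bullet>c (b \<cdot>\<^sub>v u0) = 1" using ex_scaled_unit_vec[OF u0(1,2)] by blast
    have "mat_adjoint A *\<^sub>v (b \<cdot>\<^sub>v u0) = 0\<^sub>v n"
      using mult_mat_vec[OF A' u0(1)] u0 by (auto intro!: eq_vecI)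
    then show ?thesis using True u0 b v
      by (intro exI[of _ "b \<cdot>\<^sub>v u0"] exI[of _ v] exI[of _ 0]) auto
  next
    case False
    have "cnj l \<noteq> 0" using conjugate_square_eq_0_vec[OF Av] False nAv by auto
    moreover have "cnj l \<ge> 0" using conjugate_square_ge_0_vec[of "A *\<^sub>v v"] nAv by simp
    ultimately have l: "l = complex_of_real (Re l)" "Re l > 0"
      by (auto simp: less_eq_complex_def complex_eq_iff)
    define s where "s = sqrt (Re l)"
    have s: "s > 0" "l = complex_of_real s * complex_of_real s"
      using l by (auto simp: s_def simp flip: of_real_mult)
    define u where "u = complex_of_real (1 / s) \<cdot>\<^sub>v (A *\<^sub>v v)"
    have "u \<bullet>c u = complex_of_real (1/s) * complex_of_real (1/s) * cnj l"
      using Av nAv by (simp add: u_def conjugate_smult_vec)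
    then have "u \<bullet>c u = 1" using s by simp
    moreover have "complex_of_real s \<cdot>\<^sub>v u = A *\<^sub>v v"
      using s by (simp add: u_def smult_smult_assoc)
    moreover have "mat_adjoint A *\<^sub>v u = complex_of_real s \<cdot>\<^sub>v v"
    proof -
      have "mat_adjoint A *\<^sub>v u = complex_of_real (1 / s) \<cdot>\<^sub>v (l \<cdot>\<^sub>v v)"
        unfolding u_def using mult_mat_vec[OF A' Av] ev by simp
      then show ?thesis using s by (simp add: smult_smult_assoc)
    qed
    ultimately show ?thesis using Av v by (intro exI[of _ u] exI[of _ v] exI[of _ s]) (auto simp: u_def)
  qed
qed

text \<open>Induction by deflation: in coordinates starting with \<open>u\<close> and
  \<open>v\<close> a singular pair splits off as a 1-by-1 block, and the induction hypothesis treats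
  the complementary block. The corner is self-adjoint because \<open>s\<close> is real.\<close>

lemma ex_unitary_hermitian:
  fixes A :: "complex mat"
  assumes "A \<in> carrier_mat n n"
  shows "\<exists>V W. unitary_mat n V \<and> unitary_mat n W \<and> mat_adjoint (V * A * W) = V * A * W"
  using assms
proof (induction n arbitrary: A)
  case 0
  then show ?case by (intro exI[of _ "1\<^sub>m 0"]) (auto intro!: eq_matI)
next
  case (Suc n)
  note A = Suc.prems
  let ?N = "Suc n"
  obtain u v s where uv: "u \<in> carrier_vec ?N" "v \<in> carrier_vec ?N" "u \<bullet>c u = 1" "v \<bullet>c v = 1"
    "A *\<^sub>v v = complex_of_real s \<cdot>\<^sub>v u" "mat_adjoint A *\<^sub>v u = complex_of_real s \<cdot>\<^sub>v v"
    using ex_singular_pair[OF A] by auto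
  obtain P where P: "unitary_mat ?N P" "col P 0 = u" using ex_unitary_col_0[OF uv(1,3)] by auto
  obtain Q where Q: "unitary_mat ?N Q" "col Q 0 = v" using ex_unitary_col_0[OF uv(2,4)] by auto
  note p = unitary_matD[OF P(1)] and q = unitary_matD[OF Q(1)]
  define M where "M = mat_adjoint P * A * Q"
  have M: "M \<in> carrier_mat ?N ?N" using p q A by (simp add: M_def)
  have col0: "M $$ (i, 0) = (if i = 0 then complex_of_real s else 0)" if "i < ?N" for i
  proof -
    have "col M 0 = (mat_adjoint P * A) *\<^sub>v v"
      unfolding M_def using col_mult2[of "mat_adjoint P * A" ?N ?N Q ?N 0] p q A Q(2) by simp
    also have "\<dots> = mat_adjoint P *\<^sub>v (A *\<^sub>v v)" 
      using p A uv by (intro assoc_mult_mat_vec) auto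
    also have "\<dots> = complex_of_real s \<cdot>\<^sub>v (mat_adjoint P *\<^sub>v col P 0)"
      unfolding uv(5) P(2) using p uv by (intro mult_mat_vec) auto
    also have "mat_adjoint P *\<^sub>v col P 0 = col (mat_adjoint P * P) 0"
      using col_mult2[of "mat_adjoint P" ?N ?N P ?N 0] p by simp
    also have "\<dots> = unit_vec ?N 0" using p by simp
    finally show ?thesis using M that by (auto dest!: arg_cong[of _ _ "\<lambda>x. x $ i"])
  qed
  \<comment> \<open>The second singular equation enters here: the first row of \<open>M\<close> is
    the conjugate of the first column of its adjoint.\<close>
  have row0: "M $$ (0, j) = (if j = 0 then complex_of_real s else 0)" if "j < ?N" for j
  proof -
    have M': "mat_adjoint M = mat_adjoint Q * mat_adjoint A * P"
      unfolding M_def using p q A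
      by (simp add: mat_adjoint_square_mult[of _ ?N] square_mat_assoc[of _ ?N])
    have "col (mat_adjoint M) 0 = (mat_adjoint Q * mat_adjoint A) *\<^sub>v u"
      unfolding M' using col_mult2[of "mat_adjoint Q * mat_adjoint A" ?N ?N P ?N 0] p q A P(2) by simp
    also have "\<dots> = mat_adjoint Q *\<^sub>v (mat_adjoint A *\<^sub>v u)" 
      using q A uv by (intro assoc_mult_mat_vec) auto
    also have "\<dots> = complex_of_real s \<cdot>\<^sub>v (mat_adjoint Q *\<^sub>v col Q 0)"
      unfolding uv(6) Q(2) using q uv by (intro mult_mat_vec) auto
    also have "mat_adjoint Q *\<^sub>v col Q 0 = col (mat_adjoint Q * Q) 0"
      using col_mult2[of "mat_adjoint Q" ?N ?N Q ?N 0] q by simp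
    also have "\<dots> = unit_vec ?N 0" using q by simp
    finally show ?thesis using M that
      by (auto dest!: arg_cong[of _ _ "\<lambda>x. cnj (x $ j)"] split: if_splits)
  qed
  let ?S = "mat 1 1 (\<lambda>_. complex_of_real s)"
  define B where "B = mat n n (\<lambda>(i, j). M $$ (Suc i, Suc j))"
  have B: "B \<in> carrier_mat n n" by (simp add: B_def)
  have Mb: "M = four_block_mat ?S (0\<^sub>m 1 n) (0\<^sub>m n 1) B"
    using M col0 row0 by (intro eq_matI) (auto simp: B_def)
  obtain V W where VW: "unitary_mat n V" "unitary_mat n W" "mat_adjoint (V * B * W) = V * B * W"
    using Suc.IH[OF B] by auto
  note v = unitary_matD[OF VW(1)] and w = unitary_matD[OF VW(2)]
  define D where "D X = four_block_mat (1\<^sub>m 1) (0\<^sub>m 1 n) (0\<^sub>m n 1) X" for X :: "complex mat"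
  have adj: "mat_adjoint (four_block_mat Z (0\<^sub>m 1 n) (0\<^sub>m n 1) X)
      = four_block_mat (mat_adjoint Z) (0\<^sub>m 1 n) (0\<^sub>m n 1) (mat_adjoint X)"
    if "X \<in> carrier_mat n n" "Z \<in> carrier_mat 1 1" for X Z :: "complex mat"
    using that by (intro eq_matI) auto
  have mult: "four_block_mat Z (0\<^sub>m 1 n) (0\<^sub>m n 1) X * four_block_mat Z' (0\<^sub>m 1 n) (0\<^sub>m n 1) X'
      = four_block_mat (Z * Z') (0\<^sub>m 1 n) (0\<^sub>m n 1) (X * X')"
    if "X \<in> carrier_mat n n" "Z \<in> carrier_mat 1 1" "X' \<in> carrier_mat n n" "Z' \<in> carrier_mat 1 1"
    for X Z X' Z' :: "complex mat"
    using that by (subst mult_four_block_mat[of _ 1 1 _ n _ n _ _ 1 _ n]) auto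
  have DU: "unitary_mat ?N (D X)" if "unitary_mat n X" for X
  proof (rule unitary_matI)
    note x = unitary_matD[OF that]
    show "D X \<in> carrier_mat ?N ?N"
      using four_block_carrier_mat[of "1\<^sub>m 1" 1 1 X n n] x by (auto simp: D_def)
    show "mat_adjoint (D X) * D X = 1\<^sub>m ?N"
      using x four_block_one_mat[of 1 n] by (simp add: D_def adj mult del: One_nat_def) simp
  qed
  let ?V = "D V * mat_adjoint P" and ?W = "Q * D W"
  note dv = unitary_matD[OF DU[OF VW(1)]] and dw = unitary_matD[OF DU[OF VW(2)]]
  have "?V * A * ?W = D V * M * D W"
    using dv dw p q A by (simp add: M_def square_mat_assoc[of _ ?N])
  also have "\<dots> = four_block_mat ?S (0\<^sub>m 1 n) (0\<^sub>m n 1) (V * B * W)"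
    using v w B by (simp add: D_def Mb mult square_mat_assoc[of _ n] del: One_nat_def)
  finally have eq: "?V * A * ?W = four_block_mat ?S (0\<^sub>m 1 n) (0\<^sub>m n 1) (V * B * W)" .
  moreover have "mat_adjoint ?S = ?S" by (rule eq_matI) auto
  moreover have "V * B * W \<in> carrier_mat n n" using v w B by simp
  ultimately have "mat_adjoint (?V * A * ?W) = ?V * A * ?W"
    unfolding eq using adj[of "V * B * W" ?S] unfolding VW(3) by simp
  moreover have "unitary_mat ?N ?V" "unitary_mat ?N ?W"
    using DU VW P Q by auto
  ultimately show ?case by blast
qed

subsection \<open>Skew-adjoint parts and the Cayley transform\<close>

text \<open>The skew-adjoint matrices are the tangent space of the unitary group at the identity,
  where a first-order correction by unitaries has to live.\<close>

definition skew_part :: "complex mat \<Rightarrow> complex mat" where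
  "skew_part A = (1 / 2) \<cdot>\<^sub>m (A - mat_adjoint A)"

lemma skew_part_carrier [simp]: "A \<in> carrier_mat n n \<Longrightarrow> skew_part A \<in> carrier_mat n n"
  by (simp add: skew_part_def minus_carrier_mat)

lemma dim_skew_part [simp]:
  "dim_row (skew_part A) = dim_col A" "dim_col (skew_part A) = dim_row A"
  by (simp_all add: skew_part_def)

lemma index_skew_part [simp]:
  "A \<in> carrier_mat n n \<Longrightarrow> i < n \<Longrightarrow> j < n \<Longrightarrow>
    skew_part A $$ (i, j) = (A $$ (i, j) - cnj (A $$ (j, i))) / 2"
  by (auto simp: skew_part_def)

lemma mat_adjoint_skew_part [simp]:
  "A \<in> carrier_mat n n \<Longrightarrow> mat_adjoint (skew_part A) = - skew_part A"
  by (rule eq_matI) (auto simp: field_simps)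

lemma skew_part_minus:
  "A \<in> carrier_mat n n \<Longrightarrow> B \<in> carrier_mat n n \<Longrightarrow>
    skew_part (A - B) = skew_part A - skew_part B"
  by (rule eq_matI) (auto simp: skew_part_def field_simps)

lemma skew_part_add:
  "A \<in> carrier_mat n n \<Longrightarrow> B \<in> carrier_mat n n \<Longrightarrow>
    skew_part (A + B) = skew_part A + skew_part B"
  by (rule eq_matI) (auto simp: skew_part_def field_simps)

lemma skew_part_smult_real:
  "A \<in> carrier_mat n n \<Longrightarrow>
    skew_part (complex_of_real c \<cdot>\<^sub>m A) = complex_of_real c \<cdot>\<^sub>m skew_part A"
  by (rule eq_matI) (auto simp: skew_part_def field_simps)

text \<open>With real-linearity this shows that the skew part of a coboundary is the coboundary of
  the skew part.\<close>

lemma skew_part_conj: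
  assumes P: "P \<in> carrier_mat n n" and A: "A \<in> carrier_mat n n"
  shows "skew_part (P * A * mat_adjoint P) = P * skew_part A * mat_adjoint P"
proof -
  have "mat_adjoint (P * A * mat_adjoint P) = P * mat_adjoint A * mat_adjoint P"
    using P A by (simp add: mat_adjoint_square_mult[of _ n] square_mat_assoc[of _ n])
  moreover have "P * (A - mat_adjoint A) * mat_adjoint P
      = P * A * mat_adjoint P - P * mat_adjoint A * mat_adjoint P"
    using P A by (simp add: mult_minus_distrib_mat[of _ n n _ n] minus_mult_distrib_mat[of _ n n _ _ n])
  moreover have "P * ((1/2) \<cdot>\<^sub>m (A - mat_adjoint A)) * mat_adjoint P
      = (1/2) \<cdot>\<^sub>m (P * (A - mat_adjoint A) * mat_adjoint P)"
    using P A
    by (simp add: mult_smult_distrib[of _ n n _ n] mult_smult_assoc_mat[of _ n n _ n] minus_carrier_mat)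
  ultimately show ?thesis by (simp add: skew_part_def)
qed

text \<open>\<open>C\<close> is the Cayley transform \<open>(1 - X) (1 + X)^(-1)\<close>, unitary
  because \<open>1 + X\<close> and \<open>1 - X\<close> commute and are each other's adjoints. The
  equation is stated without the inverse, so that later estimates never have to bound it.\<close>

lemma skew_imp_cayley:
  fixes X :: "complex mat"
  assumes X: "X \<in> carrier_mat n n" and skew: "mat_adjoint X = - X"
  shows "\<exists>C. unitary_mat n C \<and> C * (1\<^sub>m n + X) = 1\<^sub>m n - X"
proof -
  let ?P = "1\<^sub>m n + X" and ?M = "1\<^sub>m n - X"
  have P: "?P \<in> carrier_mat n n" and M: "?M \<in> carrier_mat n n" using X by auto
  have adjP: "mat_adjoint ?P = ?M"
    using X by (simp add: mat_adjoint_add[of _ n n] skew) (auto intro!: eq_matI)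
  then have adjM: "mat_adjoint ?M = ?P" by (metis mat_adjoint_adjoint)
  \<comment> \<open>A kernel vector satisfies \<open>X v = - v\<close>; moving \<open>X\<close>
    across the inner product by skewness gives \<open>- <v,v> = <v,v>\<close>.\<close>
  have "det ?P \<noteq> 0"
  proof
    assume "det ?P = 0"
    then obtain v where v: "v \<in> carrier_vec n" "v \<noteq> 0\<^sub>v n" "?P *\<^sub>v v = 0\<^sub>v n"
      using det_0_iff_vec_prod_zero[OF P] by auto
    have "v + X *\<^sub>v v = 0\<^sub>v n" using v X by (simp add: add_mult_distrib_mat_vec[of _ n n])
    have eq: "X *\<^sub>v v = - v"
    proof (rule eq_vecI)
      fix i assume "i < dim_vec (- v)"
      then have "(v + X *\<^sub>v v) $ i = 0" using v by (simp add: \<open>v + X *\<^sub>v v = 0\<^sub>v n\<close>)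
      then show "(X *\<^sub>v v) $ i = (- v) $ i"
        using \<open>i < dim_vec (- v)\<close> X v
        by (simp add: eq_neg_iff_add_eq_0 add.commute del: index_mult_mat_vec)
    qed (use v X in simp)
    have "- X *\<^sub>v v = v" using eq v X by (simp add: uminus_mult_mat_vec[of v])
    then have "(- v) \<bullet>c v = v \<bullet>c v"
      using mat_adjoint_mult_vec[OF X v(1) v(1)] by (simp add: eq skew)
    then have "v \<bullet>c v = 0" using v by simp
    then show False using conjugate_square_eq_0_vec[OF v(1)] v(2) by simp
  qed
  then obtain Y where Y: "Y \<in> carrier_mat n n" "?P * Y = 1\<^sub>m n"
    using det_non_zero_imp_unit[OF P] by (auto simp: Units_def ring_mat_def)
  have YP: "Y * ?P = 1\<^sub>m n" using mat_mult_left_right_inverse[OF P Y] .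
  have comm: "?P * ?M = ?M * ?P"
    using X by (simp add: add_mult_distrib_mat[of _ n n _ _ n] mult_minus_distrib_mat[of _ n n _ n]
        minus_mult_distrib_mat[of _ n n _ _ n] mult_add_distrib_mat[of _ n n _ n])
      (auto intro!: eq_matI simp del: index_mult_mat(1))
  let ?C = "?M * Y"
  have YM: "mat_adjoint Y * ?M = 1\<^sub>m n"
    using arg_cong[OF Y(2), of mat_adjoint] Y(1) P
    by (simp add: mat_adjoint_square_mult[of _ n] adjP)
  have "mat_adjoint ?C * ?C = mat_adjoint Y * (?P * ?M) * Y"
    using P M Y by (simp add: mat_adjoint_square_mult[of _ n] adjM square_mat_assoc[of _ n])
  also have "\<dots> = (mat_adjoint Y * ?M) * (?P * Y)"
    unfolding comm using P M Y by (simp add: square_mat_assoc[of _ n])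
  also have "\<dots> = 1\<^sub>m n" using Y YM by simp
  finally have "unitary_mat n ?C" using P M Y by (intro unitary_matI) auto
  moreover have "?C * ?P = ?M" using P M Y YP by (simp add: square_mat_assoc[of _ n])
  ultimately show ?thesis by blast
qed

lemma smult_minus_distrib_square:
  fixes A :: "complex mat"
  shows "A \<in> carrier_mat n n \<Longrightarrow> B \<in> carrier_mat n n \<Longrightarrow>
    c \<cdot>\<^sub>m (A - B) = c \<cdot>\<^sub>m A - c \<cdot>\<^sub>m B"
  by (rule eq_matI) (auto simp: algebra_simps)

subsection \<open>Unitarily invariant norms\<close>

locale admissible =
  fixes nrm :: "complex mat \<Rightarrow> real"
  assumes admissible: "admissible_norm nrm"
begin

lemma nrm_nonneg [simp]: "A \<in> carrier_mat k k \<Longrightarrow> nrm A \<ge> 0"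
  using admissible by (auto simp: admissible_norm_def)

lemma nrm_zero [simp]: "nrm (0\<^sub>m k k) = 0"
  using admissible zero_carrier_mat[of k k] unfolding admissible_norm_def by blast

lemma nrm_smult: "A \<in> carrier_mat k k \<Longrightarrow> nrm (c \<cdot>\<^sub>m A) = cmod c * nrm A"
  using admissible by (auto simp: admissible_norm_def)

lemma nrm_add_le: "A \<in> carrier_mat k k \<Longrightarrow> B \<in> carrier_mat k k \<Longrightarrow> nrm (A + B) \<le> nrm A + nrm B"
  using admissible by (auto simp: admissible_norm_def)

lemma nrm_mult_le: "A \<in> carrier_mat k k \<Longrightarrow> B \<in> carrier_mat k k \<Longrightarrow> nrm (A * B) \<le> nrm A * nrm B"
  using admissible by (auto simp: admissible_norm_def)

lemma nrm_unitary_conj: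
  "A \<in> carrier_mat k k \<Longrightarrow> unitary_mat k V \<Longrightarrow> unitary_mat k W \<Longrightarrow> nrm (V * A * W) = nrm A"
  using admissible by (auto simp: admissible_norm_def)

lemma nrm_unitary_left: "A \<in> carrier_mat k k \<Longrightarrow> unitary_mat k V \<Longrightarrow> nrm (V * A) = nrm A"
  using nrm_unitary_conj[of A k V "1\<^sub>m k"] by (simp add: unitary_mat_def)

lemma nrm_unitary_right: "A \<in> carrier_mat k k \<Longrightarrow> unitary_mat k V \<Longrightarrow> nrm (A * V) = nrm A"
  using nrm_unitary_conj[of A k "1\<^sub>m k" V] by (simp add: unitary_mat_def)

lemma nrm_uminus:
  assumes "A \<in> carrier_mat k k"
  shows "nrm (- A) = nrm A"
proof -
  have "- A = (-1) \<cdot>\<^sub>m A" by (intro eq_matI) auto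
  then show ?thesis using nrm_smult[OF assms, of "-1"] by simp
qed

lemma nrm_minus_commute:
  assumes "A \<in> carrier_mat k k" "B \<in> carrier_mat k k"
  shows "nrm (A - B) = nrm (B - A)"
proof -
  have "A - B = - (B - A)" using assms by (intro eq_matI) auto
  then show ?thesis using nrm_uminus[of "B - A" k] assms by simp
qed

lemma nrm_minus_self [simp]: "A \<in> carrier_mat k k \<Longrightarrow> nrm (A - A) = 0"
  using nrm_zero[of k] by simp

lemma nrm_minus_le:
  assumes "A \<in> carrier_mat k k" "B \<in> carrier_mat k k"
  shows "nrm (A - B) \<le> nrm A + nrm B"
proof -
  have "A - B = A + - B" using assms by (intro eq_matI) auto
  then show ?thesis using nrm_add_le[of A k "- B"] nrm_uminus[of B k] assms by simp
qed

lemma nrm_triangle: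
  assumes "A \<in> carrier_mat k k" "B \<in> carrier_mat k k" "C \<in> carrier_mat k k"
  shows "nrm (A - C) \<le> nrm (A - B) + nrm (B - C)"
proof -
  have "A - C = (A - B) + (B - C)" using assms by (intro eq_matI) auto
  then show ?thesis using nrm_add_le[of "A - B" k "B - C"] assms by simp
qed

lemma nrm_le_nrm_minus:
  assumes "A \<in> carrier_mat k k" "B \<in> carrier_mat k k"
  shows "nrm A \<le> nrm (A - B) + nrm B"
proof -
  have "A = (A - B) + B" using assms by (intro eq_matI) auto
  then show ?thesis using nrm_add_le[of "A - B" k B] assms by simp
qed

text \<open>Comparison through \<open>A * B'\<close>: only the unitary factors \<open>A\<close> and
  \<open>B'\<close> are split off, so the constant is 1 in every dimension.\<close>

lemma nrm_mult_minus_mult_le: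
  assumes "unitary_mat k A" "unitary_mat k B'" "A' \<in> carrier_mat k k" "B \<in> carrier_mat k k"
  shows "nrm (A * B - A' * B') \<le> nrm (A - A') + nrm (B - B')"
proof -
  note u = assms unitary_matD(1)[OF assms(1)] unitary_matD(1)[OF assms(2)]
  have "nrm (A * B - A' * B') \<le> nrm (A * B - A * B') + nrm (A * B' - A' * B')"
    using u by (intro nrm_triangle[of _ k]) auto
  moreover have "A * B - A * B' = A * (B - B')" "A * B' - A' * B' = (A - A') * B'"
    using u by (simp_all add: mult_minus_distrib_mat[of _ k k _ k] minus_mult_distrib_mat[of _ k k _ _ k])
  ultimately show ?thesis
    using u nrm_unitary_left[of "B - B'" k A] nrm_unitary_right[of "A - A'" k B'] by simp
qed

text \<open>By the singular value decomposition, \<open>V A W = D\<close> with \<open>V\<close>, \<open>W\<close> unitary and \<open>D\<close> Hermitian,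
  so \<open>A\<close> and its adjoint lie in the same unitary double coset.\<close>

lemma nrm_adjoint:
  assumes A: "A \<in> carrier_mat k k"
  shows "nrm (mat_adjoint A) = nrm A"
proof -
  obtain V W where VW: "unitary_mat k V" "unitary_mat k W" "mat_adjoint (V * A * W) = V * A * W"
    using ex_unitary_hermitian[OF A] by blast
  note u = unitary_matD(1)[OF VW(1)] unitary_matD(1)[OF VW(2)]
  have "nrm (mat_adjoint A) = nrm (mat_adjoint W * mat_adjoint A * mat_adjoint V)"
    using VW A nrm_unitary_conj[of "mat_adjoint A" k "mat_adjoint W" "mat_adjoint V"] by simp
  also have "mat_adjoint W * mat_adjoint A * mat_adjoint V = mat_adjoint (V * A * W)"
    using u A by (simp add: mat_adjoint_square_mult[of _ k] square_mat_assoc[of _ k])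
  also have "nrm \<dots> = nrm A" using VW A nrm_unitary_conj by simp
  finally show ?thesis .
qed

lemma nrm_minus_adjoint:
  "A \<in> carrier_mat k k \<Longrightarrow> B \<in> carrier_mat k k \<Longrightarrow>
    nrm (mat_adjoint A - mat_adjoint B) = nrm (A - B)"
  using nrm_adjoint[of "A - B" k] by (simp add: mat_adjoint_minus[of _ k k])

lemma nrm_skew_part_le:
  assumes A: "A \<in> carrier_mat k k"
  shows "nrm (skew_part A) \<le> nrm A"
  using nrm_minus_le[of A k "mat_adjoint A"] A
  by (simp add: skew_part_def nrm_smult[of _ k] nrm_adjoint)

lemma nrm_unitary_minus_one_skew_part:
  assumes W: "unitary_mat k W"
  shows "nrm ((W - 1\<^sub>m k) - skew_part (W - 1\<^sub>m k)) \<le> (nrm (W - 1\<^sub>m k))\<^sup>2 / 2"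
proof -
  note w = unitary_matD[OF W]
  let ?Z = "W - 1\<^sub>m k"
  have Z: "?Z \<in> carrier_mat k k" using w by simp
  have "?Z * mat_adjoint ?Z = 1\<^sub>m k - mat_adjoint W - (W - 1\<^sub>m k)"
    using w by (simp add: mat_adjoint_minus[of _ k k] minus_mult_distrib_mat[of _ k k _ _ k]
        mult_minus_distrib_mat[of _ k k _ k])
  also have "\<dots> = - (?Z + mat_adjoint ?Z)"
    using w by (intro eq_matI) (auto simp: mat_adjoint_minus[of _ k k])
  finally have zz: "?Z * mat_adjoint ?Z = - (?Z + mat_adjoint ?Z)" .
  have "?Z - skew_part ?Z = (-1/2) \<cdot>\<^sub>m (?Z * mat_adjoint ?Z)"
    unfolding zz using Z by (intro eq_matI) (auto simp: skew_part_def field_simps)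
  then have "nrm (?Z - skew_part ?Z) = nrm (?Z * mat_adjoint ?Z) / 2"
    using Z by (simp add: nrm_smult[of _ k])
  then show ?thesis
    using nrm_mult_le[of ?Z k "mat_adjoint ?Z"] Z by (simp add: nrm_adjoint power2_eq_square)
qed

text \<open>The Cayley transform replaces the exponential: it avoids power series of matrices and
  its error term is controlled by unitary invariance alone.\<close>

lemma ex_unitary_near_one:
  assumes X: "X \<in> carrier_mat k k" and skew: "mat_adjoint X = - X"
  shows "\<exists>C. unitary_mat k C \<and> nrm (C - (1\<^sub>m k - X)) \<le> (nrm X)\<^sup>2 / 2"
proof -
  \<comment> \<open>Halved because the Cayley transform of \<open>Y\<close> is
    \<open>1 - 2 Y\<close> to first order.\<close>
  let ?Y = "(1/2) \<cdot>\<^sub>m X"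
  have Y: "?Y \<in> carrier_mat k k" using X by simp
  have "mat_adjoint ?Y = - ?Y" using X by (simp add: mat_adjoint_smult skew) (auto intro!: eq_matI)
  then obtain C where C: "unitary_mat k C" "C * (1\<^sub>m k + ?Y) = 1\<^sub>m k - ?Y"
    using skew_imp_cayley[OF Y] by blast
  note c = unitary_matD(1)[OF C(1)]
  have CY: "C + C * ?Y = 1\<^sub>m k - ?Y"
    using C c Y by (simp add: mult_add_distrib_mat[of _ k k _ k])
  have *: "C $$ (i, j) + (C * ?Y) $$ (i, j) = 1\<^sub>m k $$ (i, j) - ?Y $$ (i, j)" if "i < k" "j < k" for i j
    using arg_cong[OF CY, of "\<lambda>A. A $$ (i, j)"] that c Y X by (simp del: index_mult_mat(1))
  \<comment> \<open>Using \<open>C = 1 - Y - C Y\<close> twice makes the remainder exactly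
    \<open>Y^2 + C Y^2\<close>; invariance then removes \<open>C\<close>.\<close>
  have "C - (1\<^sub>m k - X) = ?Y - C * ?Y"
    using X Y c by (intro eq_matI) (use * in \<open>auto simp: field_simps simp del: index_mult_mat(1)\<close>)
  also have "\<dots> = (1\<^sub>m k - C) * ?Y"
    using Y c by (simp add: minus_mult_distrib_mat[of _ k k _ _ k])
  also have "1\<^sub>m k - C = ?Y + C * ?Y"
    using X Y c by (intro eq_matI) (use * in \<open>auto simp: algebra_simps simp del: index_mult_mat(1)\<close>)
  also have "\<dots> * ?Y = ?Y * ?Y + C * (?Y * ?Y)"
    using Y c by (simp add: add_mult_distrib_mat[of _ k k _ _ k] square_mat_assoc[of _ k])
  finally have "nrm (C - (1\<^sub>m k - X)) \<le> nrm (?Y * ?Y) + nrm (C * (?Y * ?Y))"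
    using nrm_add_le[of "?Y * ?Y" k "C * (?Y * ?Y)"] Y c by simp
  also have "\<dots> \<le> 2 * (nrm ?Y)\<^sup>2"
    using nrm_unitary_left[of "?Y * ?Y" k C] nrm_mult_le[of ?Y k ?Y] Y C by (simp add: power2_eq_square)
  also have "\<dots> = (nrm X)\<^sup>2 / 2" using X by (simp add: nrm_smult[of _ k] power2_eq_square)
  finally show ?thesis using C by blast
qed

subsection \<open>Correction by a coboundary\<close>

text \<open>Intended reading: \<open>P\<close> and \<open>T\<close> are the lifts at
  \<open>g\<close> and \<open>gh\<close>, \<open>G\<close> and \<open>F\<close> are the word values
  representing \<open>phi_U\<close> there, and \<open>E\<close> is the failure of the lifts to be
  multiplicative. The cocycle equation is given in terms of \<open>F\<close> and \<open>G\<close>;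
  it is transferred to \<open>T\<close> and \<open>P\<close> so that afterwards only the lifts
  occur.\<close>

lemma coboundary_linearised:
  assumes P: "unitary_mat k P" and T: "unitary_mat k T"
    and F: "unitary_mat k F" and G: "unitary_mat k G"
    and E: "E \<in> carrier_mat k k"
    and b: "bg \<in> carrier_mat k k" "bh \<in> carrier_mat k k" "bgh \<in> carrier_mat k k"
    and nb: "nrm bg \<le> M" "nrm bh \<le> M" "nrm bgh \<le> M"
    and d: "d > 0"
    and \<delta>: "\<delta> = nrm ((1 / complex_of_real d) \<cdot>\<^sub>m E * mat_adjoint F
                 - (G * bh * mat_adjoint G - bgh + bg))"
    and e1: "e1 = nrm (G - P)" and e2: "e2 = nrm (F - T)"
  shows "nrm E \<le> d * (\<delta> + 3 * M)"
    and "nrm (E * mat_adjoint T - complex_of_real d \<cdot>\<^sub>m (P * bh * mat_adjoint P - bgh + bg))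
       \<le> d * ((\<delta> + 3 * M) * e2 + \<delta> + 2 * M * e1)"
proof -
  note [simp] = unitary_matD(1)[OF P] unitary_matD(1)[OF T] unitary_matD(1)[OF F]
    unitary_matD(1)[OF G] E b
  let ?d = "complex_of_real d"
  let ?a = "(1 / ?d) \<cdot>\<^sub>m E * mat_adjoint F"
  let ?DG = "G * bh * mat_adjoint G - bgh + bg" and ?DP = "P * bh * mat_adjoint P - bgh + bg"
  have M: "M \<ge> 0" using nrm_nonneg[OF b(1)] nb(1) by linarith
  have "nrm ?DG \<le> nrm (G * bh * mat_adjoint G - bgh) + nrm bg" by (rule nrm_add_le[of _ k]) auto
  also have "nrm (G * bh * mat_adjoint G - bgh) \<le> nrm (G * bh * mat_adjoint G) + nrm bgh"
    by (rule nrm_minus_le[of _ k]) auto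
  finally have "nrm ?DG \<le> 3 * M" using nrm_unitary_conj[OF b(2) G unitary_mat_adjoint[OF G]] nb by simp
  \<comment> \<open>\<open>3 * M\<close> bounds the coboundary, and \<open>\<delta>\<close> is the
    distance of the cocycle from it at the given index.\<close>
  then have na: "nrm ?a \<le> \<delta> + 3 * M"
    using nrm_le_nrm_minus[of ?a k ?DG] \<delta> by simp
  have da: "?d \<cdot>\<^sub>m ?a = E * mat_adjoint F"
    using d by (simp add: mult_smult_assoc_mat[of _ k k _ k]) (auto intro!: eq_matI)
  have "nrm E = nrm (?d \<cdot>\<^sub>m ?a)"
    unfolding da using nrm_unitary_right[OF E unitary_mat_adjoint[OF F]] by simp
  also have "\<dots> = d * nrm ?a" using d by (simp add: nrm_smult[of _ k])
  finally have nE: "nrm E = d * nrm ?a" .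
  then show "nrm E \<le> d * (\<delta> + 3 * M)" using na d by simp
  have 1: "nrm (E * mat_adjoint T - E * mat_adjoint F) \<le> d * (\<delta> + 3 * M) * e2"
  proof -
    have "E * mat_adjoint T - E * mat_adjoint F = E * (mat_adjoint T - mat_adjoint F)"
      by (simp add: mult_minus_distrib_mat[of _ k k _ k])
    then have "nrm (E * mat_adjoint T - E * mat_adjoint F) \<le> nrm E * nrm (mat_adjoint T - mat_adjoint F)"
      using nrm_mult_le[of E k "mat_adjoint T - mat_adjoint F"] by simp
    also have "nrm (mat_adjoint T - mat_adjoint F) = e2"
      using e2 nrm_minus_adjoint[of T k F] nrm_minus_commute[of T k F] by simp
    finally show ?thesis
      using \<open>nrm E \<le> d * (\<delta> + 3 * M)\<close> e2
      by (smt (verit) mult_right_mono nrm_nonneg minus_carrier_mat unitary_matD(1)[OF T])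
  qed
  have 2: "nrm (E * mat_adjoint F - ?d \<cdot>\<^sub>m ?DG) = d * \<delta>"
  proof -
    have "E * mat_adjoint F - ?d \<cdot>\<^sub>m ?DG = ?d \<cdot>\<^sub>m (?a - ?DG)"
      unfolding da[symmetric] by (simp add: smult_minus_distrib_square[of _ k])
    then show ?thesis using d \<delta> by (simp add: nrm_smult[of _ k])
  qed
  have 3: "nrm (?d \<cdot>\<^sub>m ?DG - ?d \<cdot>\<^sub>m ?DP) \<le> d * (2 * M * e1)"
  proof -
    have *: "c \<cdot>\<^sub>m (A - B' + C) - c \<cdot>\<^sub>m (A' - B' + C) = c \<cdot>\<^sub>m (A - A')"
      if "A \<in> carrier_mat k k" "A' \<in> carrier_mat k k" "B' \<in> carrier_mat k k" "C \<in> carrier_mat k k"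
      for c and A A' B' C :: "complex mat"
      using that by (intro eq_matI) (auto simp: algebra_simps)
    have "?d \<cdot>\<^sub>m ?DG - ?d \<cdot>\<^sub>m ?DP = ?d \<cdot>\<^sub>m (G * bh * mat_adjoint G - P * bh * mat_adjoint P)"
      by (rule *) auto
    then have eq: "nrm (?d \<cdot>\<^sub>m ?DG - ?d \<cdot>\<^sub>m ?DP)
        = d * nrm (G * bh * mat_adjoint G - P * bh * mat_adjoint P)"
      using d by (simp add: nrm_smult[of _ k])
    \<comment> \<open>The two conjugations are compared through the mixed term
      \<open>P * bh * mat_adjoint G\<close>; each side contributes \<open>M * e1\<close>, hence the
      factor 2.\<close>
    have "nrm (G * bh * mat_adjoint G - P * bh * mat_adjoint P)
      \<le> nrm (G * bh * mat_adjoint G - P * bh * mat_adjoint G)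
        + nrm (P * bh * mat_adjoint G - P * bh * mat_adjoint P)"
      by (rule nrm_triangle[of _ k]) auto
    also have "G * bh * mat_adjoint G - P * bh * mat_adjoint G = (G - P) * bh * mat_adjoint G"
      by (simp add: minus_mult_distrib_mat[of _ k k _ _ k])
    also have "nrm \<dots> = nrm ((G - P) * bh)"
      using nrm_unitary_right[of "(G - P) * bh" k "mat_adjoint G"] G by simp
    also have "\<dots> \<le> e1 * M"
      using nrm_mult_le[of "G - P" k bh] nb e1 mult_left_mono[OF nb(2), of e1]
        nrm_nonneg[of "G - P" k] by simp
    also have "P * bh * mat_adjoint G - P * bh * mat_adjoint P = P * (bh * (mat_adjoint G - mat_adjoint P))"
      by (simp add: mult_minus_distrib_mat[of _ k k _ k] square_mat_assoc[of _ k])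
    also have "nrm \<dots> = nrm (bh * (mat_adjoint G - mat_adjoint P))"
      using nrm_unitary_left[of _ k P] P by simp
    also have "\<dots> \<le> nrm bh * nrm (mat_adjoint G - mat_adjoint P)"
      using nrm_mult_le[of bh k] by simp
    also have "\<dots> \<le> M * e1"
      using e1 nrm_minus_adjoint[of G k P] mult_right_mono[OF nb(2), of e1]
        nrm_nonneg[of "G - P" k] by simp
    finally have "nrm (G * bh * mat_adjoint G - P * bh * mat_adjoint P) \<le> 2 * M * e1" by simp
    then show ?thesis using eq d by simp
  qed
  have "nrm (E * mat_adjoint T - ?d \<cdot>\<^sub>m ?DP)
    \<le> nrm (E * mat_adjoint T - E * mat_adjoint F) + nrm (E * mat_adjoint F - ?d \<cdot>\<^sub>m ?DP)"
    by (rule nrm_triangle[of _ k]) auto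
  also have "nrm (E * mat_adjoint F - ?d \<cdot>\<^sub>m ?DP)
    \<le> nrm (E * mat_adjoint F - ?d \<cdot>\<^sub>m ?DG) + nrm (?d \<cdot>\<^sub>m ?DG - ?d \<cdot>\<^sub>m ?DP)"
    by (rule nrm_triangle[of _ k]) auto
  finally have "nrm (E * mat_adjoint T - ?d \<cdot>\<^sub>m ?DP)
    \<le> d * (\<delta> + 3 * M) * e2 + d * \<delta> + d * (2 * M * e1)"
    using 1 2 3 by linarith
  then show "nrm (E * mat_adjoint T - ?d \<cdot>\<^sub>m ?DP) \<le> d * ((\<delta> + 3 * M) * e2 + \<delta> + 2 * M * e1)"
    by (simp add: algebra_simps)
qed

text \<open>The matrix on the left is exactly \<open>(A - 1) (B - 1)\<close>, hence of second order
  when both factors are near the identity.\<close>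

lemma nrm_mult_minus_one_le:
  assumes "A \<in> carrier_mat k k" "B \<in> carrier_mat k k"
  shows "nrm ((A * B - 1\<^sub>m k) - ((A - 1\<^sub>m k) + (B - 1\<^sub>m k))) \<le> nrm (A - 1\<^sub>m k) * nrm (B - 1\<^sub>m k)"
proof -
  have "(A * B - 1\<^sub>m k) - ((A - 1\<^sub>m k) + (B - 1\<^sub>m k)) = A * B - A - (B - 1\<^sub>m k)"
    using assms by (intro eq_matI) (auto simp del: index_mult_mat(1))
  also have "\<dots> = (A - 1\<^sub>m k) * (B - 1\<^sub>m k)"
    using assms
    by (simp add: minus_mult_distrib_mat[of _ k k _ _ k] mult_minus_distrib_mat[of _ k k _ k])
      (auto intro!: eq_matI simp del: index_mult_mat(1))
  finally show ?thesis using nrm_mult_le[of "A - 1\<^sub>m k" k "B - 1\<^sub>m k"] assms by simp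
qed

text \<open>Factoring out \<open>T\<close> leaves a product of the three unitaries \<open>Cg\<close>, \<open>P Ch P\<^sup>*\<close> and \<open>P Q T\<^sup>*\<close>, all
  within \<open>O(d)\<close> of \<open>1\<close>; their deviations from \<open>1\<close> add up to that of \<open>Cgh\<close> to first order.\<close>

lemma coboundary_correction:
  assumes P: "unitary_mat k P" and Q: "unitary_mat k Q" and T: "unitary_mat k T"
    and F: "unitary_mat k F" and G: "unitary_mat k G"
    and C: "unitary_mat k Cg" "unitary_mat k Ch" "unitary_mat k Cgh"
    and b: "bg \<in> carrier_mat k k" "bh \<in> carrier_mat k k" "bgh \<in> carrier_mat k k"
    and nb: "nrm bg \<le> M" "nrm bh \<le> M" "nrm bgh \<le> M"
    and d: "d > 0"
    and nC: "nrm (Cg - (1\<^sub>m k - complex_of_real d \<cdot>\<^sub>m skew_part bg)) \<le> d\<^sup>2 * M\<^sup>2"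
       "nrm (Ch - (1\<^sub>m k - complex_of_real d \<cdot>\<^sub>m skew_part bh)) \<le> d\<^sup>2 * M\<^sup>2"
       "nrm (Cgh - (1\<^sub>m k - complex_of_real d \<cdot>\<^sub>m skew_part bgh)) \<le> d\<^sup>2 * M\<^sup>2"
    and \<delta>: "\<delta> = nrm ((1 / complex_of_real d) \<cdot>\<^sub>m (P * Q - T) * mat_adjoint F
                 - (G * bh * mat_adjoint G - bgh + bg))"
    and e1: "e1 = nrm (G - P)" and e2: "e2 = nrm (F - T)"
    and \<kappa>: "\<kappa> = \<delta> + 3 * M" and \<mu>: "\<mu> = M + d * M\<^sup>2"
  shows "nrm (Cg * P * (Ch * Q) - Cgh * T)
    \<le> d * (d * (\<mu> * (\<mu> + \<kappa>) + \<mu> * \<kappa> + 3 * M\<^sup>2 + \<kappa>\<^sup>2 / 2) + \<kappa> * e2 + \<delta> + 2 * M * e1)"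
proof -
  note [simp] = unitary_matD(1)[OF P] unitary_matD(1)[OF Q] unitary_matD(1)[OF T]
    unitary_matD(1)[OF F] unitary_matD(1)[OF G] unitary_matD(1)[OF C(1)]
    unitary_matD(1)[OF C(2)] unitary_matD(1)[OF C(3)] b
  let ?d = "complex_of_real d" and ?I = "1\<^sub>m k :: complex mat"
  define X where "X = Cg - ?I"
  define Y where "Y = P * Ch * mat_adjoint P - ?I"
  define Z where "Z = P * Q * mat_adjoint T - ?I"
  define V where "V = Cgh - ?I"
  let ?Sg = "skew_part bg" and ?Sh = "P * skew_part bh * mat_adjoint P" and ?Sgh = "skew_part bgh"
  have [simp]: "X \<in> carrier_mat k k" "Y \<in> carrier_mat k k" "Z \<in> carrier_mat k k" "V \<in> carrier_mat k k"
    by (simp_all add: X_def Y_def Z_def V_def)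
  have M: "M \<ge> 0" using nrm_nonneg[OF b(1)] nb(1) by linarith
  have "\<delta> \<ge> 0" unfolding \<delta> by (rule nrm_nonneg[of _ k]) simp
  then have \<kappa>0: "\<kappa> \<ge> 0" and \<mu>0: "\<mu> \<ge> 0" using M d by (simp_all add: \<kappa> \<mu>)
  have minus_add: "A - (?I - B) = (A - ?I) + B"
    if "A \<in> carrier_mat k k" "B \<in> carrier_mat k k" for A B
    using that by (intro eq_matI) auto
  have X: "nrm (X + ?d \<cdot>\<^sub>m ?Sg) \<le> d\<^sup>2 * M\<^sup>2"
    using nC(1) by (simp add: minus_add X_def)
  have V: "nrm (V + ?d \<cdot>\<^sub>m ?Sgh) \<le> d\<^sup>2 * M\<^sup>2"
    using nC(3) by (simp add: minus_add V_def)
  \<comment> \<open>Conjugation by the unitary \<open>P\<close> preserves the estimate for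
    \<open>Ch\<close>; this is where the action of the group on the cochain comes in.\<close>
  have Y: "nrm (Y + ?d \<cdot>\<^sub>m ?Sh) \<le> d\<^sup>2 * M\<^sup>2"
  proof -
    have "P * ((Ch - ?I) + ?d \<cdot>\<^sub>m skew_part bh) * mat_adjoint P = Y + ?d \<cdot>\<^sub>m ?Sh"
      using unitary_matD(2)[OF P]
      by (simp add: Y_def mult_add_distrib_mat[of _ k k _ k] add_mult_distrib_mat[of _ k k _ _ k]
          mult_minus_distrib_mat[of _ k k _ k] minus_mult_distrib_mat[of _ k k _ _ k]
          mult_smult_distrib[of _ k k _ k] mult_smult_assoc_mat[of _ k k _ k])
    then have "nrm (Y + ?d \<cdot>\<^sub>m ?Sh) = nrm ((Ch - ?I) + ?d \<cdot>\<^sub>m skew_part bh)"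
      using nrm_unitary_conj[of "(Ch - ?I) + ?d \<cdot>\<^sub>m skew_part bh" k P "mat_adjoint P"] P by simp
    then show ?thesis using nC(2) by (simp add: minus_add)
  qed
  \<comment> \<open>Origin of \<open>\<mu>\<close>: a linear term of size \<open>d * M\<close> plus
    the Cayley error \<open>d^2 * M^2\<close>.\<close>
  have bound: "nrm A \<le> d * \<mu>"
    if "nrm (A + ?d \<cdot>\<^sub>m S) \<le> d\<^sup>2 * M\<^sup>2" "nrm S \<le> M" "A \<in> carrier_mat k k" "S \<in> carrier_mat k k" for A S
  proof -
    have "A = (A + ?d \<cdot>\<^sub>m S) - ?d \<cdot>\<^sub>m S" using that by (intro eq_matI) auto
    then have "nrm A \<le> nrm (A + ?d \<cdot>\<^sub>m S) + nrm (?d \<cdot>\<^sub>m S)"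
      using nrm_minus_le[of "A + ?d \<cdot>\<^sub>m S" k "?d \<cdot>\<^sub>m S"] that by simp
    also have "nrm (?d \<cdot>\<^sub>m S) \<le> d * M" using that d by (simp add: nrm_smult[of _ k])
    finally show ?thesis using that(1) by (simp add: \<mu> algebra_simps power2_eq_square)
  qed
  have nS: "nrm ?Sg \<le> M" "nrm ?Sh \<le> M" 
    using nrm_skew_part_le[OF b(1)] nrm_skew_part_le[OF b(2)] nb P
      nrm_unitary_conj[of "skew_part bh" k P "mat_adjoint P"] by auto
  have nX: "nrm X \<le> d * \<mu>" and nY: "nrm Y \<le> d * \<mu>"
    using bound[OF X nS(1)] bound[OF Y nS(2)] by auto
  let ?D = "P * bh * mat_adjoint P - bgh + bg"
  note lin = coboundary_linearised[OF P T F G _ b nb d \<delta> e1 e2, folded \<kappa>, simplified]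
  have ZE: "Z = (P * Q - T) * mat_adjoint T"
    using unitary_matD(2)[OF T] by (simp add: Z_def minus_mult_distrib_mat[of _ k k _ _ k])
  have nZ: "nrm Z \<le> d * \<kappa>"
    using lin(1) T nrm_unitary_right[of "P * Q - T" k "mat_adjoint T"] by (simp add: ZE)
  \<comment> \<open>\<open>Z + 1\<close> is unitary, so \<open>Z\<close> is skew-adjoint up to
    second order. For this reason it suffices that the skew part of the cochain matches.\<close>
  have Zs: "nrm (Z - skew_part Z) \<le> d\<^sup>2 * (\<kappa>\<^sup>2 / 2)"
  proof -
    have "nrm (Z - skew_part Z) \<le> (nrm Z)\<^sup>2 / 2"
      unfolding Z_def by (rule nrm_unitary_minus_one_skew_part) (use P Q T in auto)
    also have "\<dots> \<le> (d * \<kappa>)\<^sup>2 / 2" using nZ nrm_nonneg[of Z k] by (intro divide_right_mono power_mono) auto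
    finally show ?thesis by (simp add: power_mult_distrib)
  qed
  have sD: "skew_part (Z - ?d \<cdot>\<^sub>m ?D) = skew_part Z - ?d \<cdot>\<^sub>m (?Sh - ?Sgh + ?Sg)"
    by (simp add: skew_part_minus[of _ k] skew_part_add[of _ k] skew_part_smult_real[of _ k]
        skew_part_conj[of _ k])
  have ZD: "nrm (skew_part Z - ?d \<cdot>\<^sub>m (?Sh - ?Sgh + ?Sg)) \<le> d * (\<kappa> * e2 + \<delta> + 2 * M * e1)"
    using lin(2) nrm_skew_part_le[of "Z - ?d \<cdot>\<^sub>m ?D" k] unfolding sD[symmetric] by (simp add: ZE)
  have lin_part: "nrm (X + Y + Z - V) \<le> 3 * (d\<^sup>2 * M\<^sup>2) + d\<^sup>2 * (\<kappa>\<^sup>2 / 2) + d * (\<kappa> * e2 + \<delta> + 2 * M * e1)"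
  proof -
    \<comment> \<open>The first-order terms cancel: the corrections contribute
      \<open>- c A1\<close>, \<open>- c A2\<close> and \<open>c A3\<close>, the lifts contribute
      \<open>c (A2 - A3 + A1)\<close>. The identity is stated for arbitrary matrices so that the
      entrywise proof does not unfold the products to which it is applied.\<close>
    have regroup: "X + Y + Z - V = ((X + c \<cdot>\<^sub>m A1) + (Y + c \<cdot>\<^sub>m A2) - (V + c \<cdot>\<^sub>m A3))
        + ((Z - S) + (S - c \<cdot>\<^sub>m (A2 - A3 + A1)))"
      if "A1 \<in> carrier_mat k k" "A2 \<in> carrier_mat k k" "A3 \<in> carrier_mat k k" "S \<in> carrier_mat k k"
        "X \<in> carrier_mat k k" "Y \<in> carrier_mat k k" "Z \<in> carrier_mat k k" "V \<in> carrier_mat k k"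
      for c and A1 A2 A3 S X Y Z V :: "complex mat"
      using that by (intro eq_matI) (auto simp: algebra_simps)
    have "X + Y + Z - V = ((X + ?d \<cdot>\<^sub>m ?Sg) + (Y + ?d \<cdot>\<^sub>m ?Sh) - (V + ?d \<cdot>\<^sub>m ?Sgh))
        + ((Z - skew_part Z) + (skew_part Z - ?d \<cdot>\<^sub>m (?Sh - ?Sgh + ?Sg)))"
      (is "_ = (?A + ?B - ?C) + (?E + ?H)")
      by (rule regroup) auto
    also have "nrm \<dots> \<le> nrm (?A + ?B - ?C) + nrm (?E + ?H)" by (rule nrm_add_le[of _ k]) auto
    also have "nrm (?E + ?H) \<le> nrm ?E + nrm ?H" by (rule nrm_add_le[of _ k]) auto
    also have "nrm (?A + ?B - ?C) \<le> nrm (?A + ?B) + nrm ?C" by (rule nrm_minus_le[of _ k]) auto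
    also have "nrm (?A + ?B) \<le> nrm ?A + nrm ?B" by (rule nrm_add_le[of _ k]) auto
    finally show ?thesis using X Y V Zs ZD by linarith
  qed
  define K where "K = P * Ch * mat_adjoint P"
  define L where "L = P * Q * mat_adjoint T"
  have KL: "unitary_mat k K" "unitary_mat k L" using P Q T C by (simp_all add: K_def L_def)
  note [simp] = unitary_matD(1)[OF KL(1)] unitary_matD(1)[OF KL(2)]
  have YZ: "Y = K - ?I" "Z = L - ?I" by (simp_all add: Y_def Z_def K_def L_def)
  have nKL: "nrm (K * L - ?I) \<le> d * \<mu> + d * \<kappa>"
    using nrm_mult_minus_mult_le[of k K ?I ?I L] KL nY nZ by (simp add: YZ)
  have KLl: "nrm ((K * L - ?I) - (Y + Z)) \<le> (d * \<mu>) * (d * \<kappa>)"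
    using nrm_mult_minus_one_le[of K k L] mult_mono[OF nY nZ] d \<mu>0
      nrm_nonneg[of "L - ?I" k] by (simp add: YZ)
  have CKL: "nrm ((Cg * (K * L) - ?I) - (X + (K * L - ?I))) \<le> (d * \<mu>) * (d * \<mu> + d * \<kappa>)"
    using nrm_mult_minus_one_le[of Cg k "K * L"] mult_mono[OF nX nKL] d \<mu>0 \<kappa>0
      nrm_nonneg[of "K * L - ?I" k] by (simp add: X_def)
  have "Cg * (K * L) * T = Cg * P * (Ch * Q)"
  proof -
    have "K * L * T = P * Ch * Q"
      unfolding K_def L_def using unitary_matD(3)[OF P] unitary_matD(3)[OF T]
      by (simp add: square_mat_assoc[of _ k] square_mat_cancel_left[of "mat_adjoint P" P k])
    then show ?thesis by (simp add: square_mat_assoc[of _ k])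
  qed
  then have factor: "Cg * P * (Ch * Q) - Cgh * T = (Cg * (K * L) - Cgh) * T"
    by (simp add: minus_mult_distrib_mat[of _ k k _ _ k])
  \<comment> \<open>Telescoping into two quadratic remainders, one for each multiplication, and the
    first-order sum bounded in \<open>lin_part\<close>.\<close>
  have regroup: "A - B = ((A - ?I) - (X + (H - ?I))) + (((H - ?I) - (Y + Z)) + (X + Y + Z - V'))"
    if "A \<in> carrier_mat k k" "B \<in> carrier_mat k k" "H \<in> carrier_mat k k" "V' = B - ?I" "X \<in> carrier_mat k k"
      "Y \<in> carrier_mat k k" "Z \<in> carrier_mat k k" for A B H X Y Z V'
    using that by (intro eq_matI) auto
  from factor have "nrm (Cg * P * (Ch * Q) - Cgh * T) = nrm (Cg * (K * L) - Cgh)"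
    using nrm_unitary_right[of "Cg * (K * L) - Cgh" k T] T by simp
  also have "Cg * (K * L) - Cgh = ((Cg * (K * L) - ?I) - (X + (K * L - ?I)))
      + (((K * L - ?I) - (Y + Z)) + (X + Y + Z - V))"
    (is "_ = ?A + (?B + ?C)")
    by (rule regroup) (simp_all add: V_def)
  also have "nrm \<dots> \<le> nrm ?A + nrm (?B + ?C)" by (rule nrm_add_le[of _ k]) auto
  also have "nrm (?B + ?C) \<le> nrm ?B + nrm ?C" by (rule nrm_add_le[of _ k]) auto
  finally have "nrm (Cg * P * (Ch * Q) - Cgh * T) \<le> (d * \<mu>) * (d * \<mu> + d * \<kappa>) + (d * \<mu>) * (d * \<kappa>)
     + (3 * (d\<^sup>2 * M\<^sup>2) + d\<^sup>2 * (\<kappa>\<^sup>2 / 2) + d * (\<kappa> * e2 + \<delta> + 2 * M * e1))"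
    using CKL KLl lin_part by linarith
  then show ?thesis by (simp add: algebra_simps power2_eq_square)
qed

end

subsection \<open>Words and the presented group\<close>

lemma pres_eq_in_context: "pres_eq R u v \<Longrightarrow> pres_eq R (a @ u @ b) (a @ v @ b)"
proof (induction rule: pres_eq.induct)
  case (cancel u s b' v)
  show ?case using pres_eq.cancel[of R "a @ u" s b' "v @ b"] by simp
next
  case (relator r u v)
  then show ?case using pres_eq.relator[of r R "a @ u" "v @ b"] by simp
qed (auto intro: pres_eq.intros)

lemma pres_eq_append: "pres_eq R u u' \<Longrightarrow> pres_eq R v v' \<Longrightarrow> pres_eq R (u @ v) (u' @ v')"
  using pres_eq_in_context[of R u u' "[]" v] pres_eq_in_context[of R v v' u' "[]"]
  by (auto intro: pres_eq.trans)

lemma cls_eq_iff: "cls R u = cls R v \<longleftrightarrow> pres_eq R u v"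
  unfolding cls_def by (blast intro: pres_eq.intros)

lemma cls_in_Gamma [simp]: "cls R w \<in> Gamma R"
  by (simp add: Gamma_def)

lemma some_in_cls: "pres_eq R w (SOME v. v \<in> cls R w)"
  using someI[of "\<lambda>v. v \<in> cls R w" w] by (auto simp: cls_def intro: pres_eq.refl)

text \<open>\<open>gmul\<close> multiplies chosen representatives; compatibility of the relation
  with concatenation makes the choice immaterial.\<close>

lemma gmul_cls: "gmul R (cls R u) (cls R v) = cls R (u @ v)"
  unfolding gmul_def cls_eq_iff by (intro pres_eq.sym[OF pres_eq_append] some_in_cls)

lemma gmul_in_Gamma [simp]: "gmul R g h \<in> Gamma R"
  by (simp add: gmul_def)

lemma eval_word_Nil [simp]: "eval_word k f [] = 1\<^sub>m k"
  by (simp add: eval_word_def)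

lemma eval_word_Cons:
  "eval_word k f ((s, b) # w) = (if b then f s else mat_adjoint (f s)) * eval_word k f w"
  by (simp add: eval_word_def)

context
  fixes k :: nat and f :: "'s \<Rightarrow> complex mat"
  assumes f: "\<And>s. unitary_mat k (f s)"
begin

lemma unitary_eval_word: "unitary_mat k (eval_word k f w)"
  by (induction w) (auto simp: eval_word_Cons f)

lemma eval_word_append: "eval_word k f (u @ v) = eval_word k f u * eval_word k f v"
proof (induction u)
  case Nil
  then show ?case using unitary_matD(1)[OF unitary_eval_word] by simp
next
  case (Cons a u)
  then show ?case
    using unitary_matD(1)[OF unitary_eval_word] unitary_matD(1)[OF f]
    by (cases a) (simp add: eval_word_Cons square_mat_assoc[of _ k])
qed

lemma eval_word_singleton: "eval_word k f [(s, True)] = f s"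
  using unitary_matD(1)[OF f] by (simp add: eval_word_Cons)

lemma eval_word_cancel: "eval_word k f (u @ [(s, b), (s, \<not> b)] @ v) = eval_word k f (u @ v)"
proof -
  have "eval_word k f [(s, b), (s, \<not> b)] = 1\<^sub>m k"
    using unitary_matD[OF f[of s]] by (simp add: eval_word_Cons)
  then show ?thesis
    using unitary_matD(1)[OF unitary_eval_word] by (simp only: eval_word_append) simp
qed

end

lemma defect_nonneg:
  assumes "finite R"
  shows "defect nrm R k f \<ge> 0"
  using assms by (simp add: defect_def)

lemma nrm_relator_le_defect:
  assumes "finite R" "r \<in> R"
  shows "nrm (eval_word k f r - 1\<^sub>m k) \<le> defect nrm R k f"
  using assms by (simp add: defect_def)

lemma tendsto_zero_squeeze:
  fixes x y :: "'a \<Rightarrow> real"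
  assumes "(y \<longlongrightarrow> 0) F" "\<And>n. 0 \<le> x n" "eventually (\<lambda>n. x n \<le> y n) F"
  shows "(x \<longlongrightarrow> 0) F"
  by (rule tendsto_sandwich[OF _ assms(3) tendsto_const assms(1)]) (use assms(2) in simp)

context admissible
begin

text \<open>Each use of a relator costs one defect, since its unitary context drops out of the norm,
  and free cancellation costs nothing. The constant thus reflects the derivation alone and is
  uniform in \<open>k\<close> and \<open>f\<close>.\<close>

lemma pres_eq_imp_eval_word_close:
  assumes "pres_eq R w v" and R: "finite R"
  shows "\<exists>C. \<forall>k f. (\<forall>s. unitary_mat k (f s)) \<longrightarrow>
    nrm (eval_word k f w - eval_word k f v) \<le> C * defect nrm R k f"
  using assms(1)
proof induction
  case (refl w)
  show ?case
  proof (intro exI[of _ 0] allI impI)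
    fix k and f :: "'a \<Rightarrow> complex mat" assume "\<forall>s. unitary_mat k (f s)"
    then show "nrm (eval_word k f w - eval_word k f w) \<le> 0 * defect nrm R k f"
      using nrm_minus_self[OF unitary_matD(1)[OF unitary_eval_word[of k f]]] by simp
  qed
next
  case (sym w v)
  then show ?case
    using unitary_matD(1)[OF unitary_eval_word] by (metis nrm_minus_commute)
next
  case (trans u v w)
  obtain C D where
    C: "\<And>k f. (\<forall>s. unitary_mat k (f s)) \<Longrightarrow>
      nrm (eval_word k f u - eval_word k f v) \<le> C * defect nrm R k f" and
    D: "\<And>k f. (\<forall>s. unitary_mat k (f s)) \<Longrightarrow>
      nrm (eval_word k f v - eval_word k f w) \<le> D * defect nrm R k f"
    using trans.IH by blast
  show ?case
  proof (intro exI[of _ "C + D"] allI impI)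
    fix k and f :: "'a \<Rightarrow> complex mat" assume f: "\<forall>s. unitary_mat k (f s)"
    have "nrm (eval_word k f u - eval_word k f w)
      \<le> nrm (eval_word k f u - eval_word k f v) + nrm (eval_word k f v - eval_word k f w)"
      using unitary_matD(1)[OF unitary_eval_word] f by (intro nrm_triangle[of _ k]) auto
    then show "nrm (eval_word k f u - eval_word k f w) \<le> (C + D) * defect nrm R k f"
      using C[OF f] D[OF f] by (simp add: distrib_right)
  qed
next
  case (cancel u s b v)
  show ?case
  proof (intro exI[of _ 0] allI impI)
    fix k and f :: "'a \<Rightarrow> complex mat" assume "\<forall>s. unitary_mat k (f s)"
    then have f: "\<And>s. unitary_mat k (f s)" by blast
    show "nrm (eval_word k f (u @ [(s, b), (s, \<not> b)] @ v) - eval_word k f (u @ v)) \<le> 0 * defect nrm R k f"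
      using nrm_minus_self[OF unitary_matD(1)[OF unitary_eval_word[of k f, OF f]]]
      by (simp only: eval_word_cancel[OF f])
  qed
next
  case (relator r u v)
  show ?case
  proof (intro exI[of _ 1] allI impI)
    fix k and f :: "'a \<Rightarrow> complex mat" assume "\<forall>s. unitary_mat k (f s)"
    then have f: "\<And>s. unitary_mat k (f s)" by blast
    note c = unitary_matD(1)[OF unitary_eval_word[of k f, OF f]]
    have "eval_word k f (u @ r @ v) - eval_word k f (u @ v)
        = eval_word k f u * (eval_word k f r - 1\<^sub>m k) * eval_word k f v"
      using c by (simp add: eval_word_append[OF f] mult_minus_distrib_mat[of _ k k _ k]
          minus_mult_distrib_mat[of _ k k _ _ k] square_mat_assoc[of _ k])
    then show "nrm (eval_word k f (u @ r @ v) - eval_word k f (u @ v)) \<le> 1 * defect nrm R k f"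
      using nrm_unitary_conj[of "eval_word k f r - 1\<^sub>m k" k] c unitary_eval_word[of k f, OF f]
        nrm_relator_le_defect[OF R \<open>r \<in> R\<close>, of nrm k f] by simp
  qed
qed

section \<open>Unitary-valued maps on the group that are multiplicative up to
  \<open>o(d)\<close>\<close>

context
  fixes U :: "nat filter" and R :: "'s word set" and k :: "nat \<Rightarrow> nat" and d :: "nat \<Rightarrow> real"
    and rho :: "nat \<Rightarrow> 's word set \<Rightarrow> complex mat"
  assumes d_nonneg: "\<And>n. d n \<ge> 0"
    and rho_unitary: "\<And>n g. g \<in> Gamma R \<Longrightarrow> unitary_mat (k n) (rho n g)"
    and rho_mult: "\<And>g h. g \<in> Gamma R \<Longrightarrow> h \<in> Gamma R \<Longrightarrow>
      ((\<lambda>n. nrm (rho n g * rho n h - rho n (gmul R g h)) / d n) \<longlongrightarrow> 0) U"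
begin

lemma rho_carrier: "g \<in> Gamma R \<Longrightarrow> rho n g \<in> carrier_mat (k n) (k n)"
  using rho_unitary unitary_matD(1) by blast

text \<open>A unitary that is almost idempotent is almost 1, by cancelling one factor. An argument
  is called for because the correcting unitary at the neutral element may differ from 1.\<close>

lemma almost_hom_unit: "((\<lambda>n. nrm (rho n (cls R []) - 1\<^sub>m (k n)) / d n) \<longlongrightarrow> 0) U"
proof -
  have "nrm (rho n (cls R []) * rho n (cls R []) - rho n (cls R [])) = nrm (rho n (cls R []) - 1\<^sub>m (k n))" for n
  proof -
    let ?r = "rho n (cls R [])"
    note c = rho_carrier[OF cls_in_Gamma[of R "[]"], of n]
    have "?r * ?r - ?r = ?r * (?r - 1\<^sub>m (k n))"
      using c by (simp add: mult_minus_distrib_mat[of _ "k n" "k n" _ "k n"])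
    then show ?thesis
      using nrm_unitary_left[of "?r - 1\<^sub>m (k n)" "k n" ?r] c rho_unitary[OF cls_in_Gamma] by simp
  qed
  then show ?thesis
    using rho_mult[OF cls_in_Gamma[of R "[]"] cls_in_Gamma[of R "[]"]] by (simp add: gmul_cls)
qed

text \<open>\<open>eval_word\<close> reads an inverse letter as an adjoint, whereas the map has its
  own value at the inverse. Both are almost inverse to the value at the generator, and multiplying
  by that unitary preserves their distance.\<close>

lemma almost_hom_inverse_letter:
  "((\<lambda>n. nrm (mat_adjoint (rho n (cls R [(s, True)])) - rho n (cls R [(s, False)])) / d n) \<longlongrightarrow> 0) U"
proof (rule tendsto_zero_squeeze)
  let ?a = "\<lambda>n. rho n (cls R [(s, True)])" and ?b = "\<lambda>n. rho n (cls R [(s, False)])"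
  let ?e = "\<lambda>n. rho n (cls R [])"
  have "cls R [(s, True), (s, False)] = cls R []"
    unfolding cls_eq_iff using pres_eq.cancel[of R "[]" s True "[]"] by simp
  then have "((\<lambda>n. nrm (?a n * ?b n - ?e n) / d n) \<longlongrightarrow> 0) U"
    using rho_mult[OF cls_in_Gamma[of R "[(s, True)]"] cls_in_Gamma[of R "[(s, False)]"]]
    by (simp add: gmul_cls)
  then show "((\<lambda>n. nrm (?a n * ?b n - ?e n) / d n + nrm (?e n - 1\<^sub>m (k n)) / d n) \<longlongrightarrow> 0) U"
    using almost_hom_unit by (rule tendsto_add_zero)
  note c = rho_carrier[OF cls_in_Gamma]
  have "nrm (mat_adjoint (?a n) - ?b n) \<le> nrm (?a n * ?b n - ?e n) + nrm (?e n - 1\<^sub>m (k n))" for n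
  proof -
    note u = rho_unitary[OF cls_in_Gamma, of n]
    have "?a n * (?b n - mat_adjoint (?a n)) = ?a n * ?b n - 1\<^sub>m (k n)"
      using c unitary_matD(2)[OF u] by (simp add: mult_minus_distrib_mat[of _ "k n" "k n" _ "k n"])
    then have "nrm (?b n - mat_adjoint (?a n)) = nrm (?a n * ?b n - 1\<^sub>m (k n))"
      using nrm_unitary_left[of "?b n - mat_adjoint (?a n)" "k n" "?a n"] c u by simp
    then show ?thesis
      using nrm_triangle[of "?a n * ?b n" "k n" "?e n" "1\<^sub>m (k n)"] c
        nrm_minus_commute[of "?b n" "k n" "mat_adjoint (?a n)"] by simp
  qed
  then show "eventually (\<lambda>n. nrm (mat_adjoint (?a n) - ?b n) / d n
      \<le> nrm (?a n * ?b n - ?e n) / d n + nrm (?e n - 1\<^sub>m (k n)) / d n) U"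
    using d_nonneg by (intro always_eventually allI) (simp add: divide_right_mono flip: add_divide_distrib)
  show "0 \<le> nrm (mat_adjoint (?a n) - ?b n) / d n" for n
    using c d_nonneg nrm_nonneg[of "mat_adjoint (?a n) - ?b n" "k n"] by simp
qed

text \<open>Each letter adds a letter error and a multiplication error, both \<open>o(d)\<close>; a
  fixed word collects finitely many of them.\<close>

lemma almost_hom_eval_word:
  "((\<lambda>n. nrm (eval_word (k n) (\<lambda>s. rho n (cls R [(s, True)])) w - rho n (cls R w)) / d n) \<longlongrightarrow> 0) U"
proof (induction w)
  case Nil
  have "nrm (1\<^sub>m (k n) - rho n (cls R [])) = nrm (rho n (cls R []) - 1\<^sub>m (k n))" for n
    using rho_carrier[OF cls_in_Gamma] by (intro nrm_minus_commute[of _ "k n"]) auto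
  then show ?case using almost_hom_unit by simp
next
  case (Cons a w)
  obtain s b where a: "a = (s, b)" by force
  let ?f = "\<lambda>n s. rho n (cls R [(s, True)])"
  let ?E = "\<lambda>n w. eval_word (k n) (?f n) w"
  let ?L = "\<lambda>n. if b then ?f n s else mat_adjoint (?f n s)"
  have f: "unitary_mat (k n) (?f n s)" for n s using rho_unitary by simp
  have E: "unitary_mat (k n) (?E n v)" for n v by (rule unitary_eval_word) (rule f)
  note u = rho_unitary[OF cls_in_Gamma] E
  note c = rho_carrier[OF cls_in_Gamma] unitary_matD(1)[OF E]
  have letter: "((\<lambda>n. nrm (?L n - rho n (cls R [a])) / d n) \<longlongrightarrow> 0) U"
  proof (cases b)
    case True
    then show ?thesis
      using nrm_minus_self[OF rho_carrier[OF cls_in_Gamma]] by (simp add: a)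
  next
    case False
    then show ?thesis using almost_hom_inverse_letter[of s] by (simp add: a)
  qed
  have prod: "((\<lambda>n. nrm (rho n (cls R [a]) * rho n (cls R w) - rho n (cls R (a # w))) / d n) \<longlongrightarrow> 0) U"
    using rho_mult[OF cls_in_Gamma[of R "[a]"] cls_in_Gamma[of R w]] by (simp add: gmul_cls)
  show ?case
  proof (rule tendsto_zero_squeeze)
    let ?y = "\<lambda>n. (nrm (?L n - rho n (cls R [a])) / d n + nrm (?E n w - rho n (cls R w)) / d n)
      + nrm (rho n (cls R [a]) * rho n (cls R w) - rho n (cls R (a # w))) / d n"
    show "(?y \<longlongrightarrow> 0) U" by (intro tendsto_add_zero letter prod Cons.IH)
    have "nrm (?E n (a # w) - rho n (cls R (a # w)))
      \<le> nrm (?L n - rho n (cls R [a])) + nrm (?E n w - rho n (cls R w))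
        + nrm (rho n (cls R [a]) * rho n (cls R w) - rho n (cls R (a # w)))" for n
    proof -
      have L: "unitary_mat (k n) (?L n)" using f[of n s] by simp
      have EL: "?E n (a # w) = ?L n * ?E n w" by (simp add: a eval_word_Cons)
      have "nrm (?L n * ?E n w - rho n (cls R (a # w)))
        \<le> nrm (?L n * ?E n w - rho n (cls R [a]) * rho n (cls R w))
          + nrm (rho n (cls R [a]) * rho n (cls R w) - rho n (cls R (a # w)))"
        using c square_mat_mult_carrier[OF unitary_matD(1)[OF L] unitary_matD(1)[OF E]]
        by (intro nrm_triangle[of _ "k n"]) auto
      moreover have "nrm (?L n * ?E n w - rho n (cls R [a]) * rho n (cls R w))
        \<le> nrm (?L n - rho n (cls R [a])) + nrm (?E n w - rho n (cls R w))"
        by (rule nrm_mult_minus_mult_le[OF L u(1) c(1) c(2)])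
      ultimately show ?thesis unfolding EL by linarith
    qed
    then show "eventually (\<lambda>n. nrm (?E n (a # w) - rho n (cls R (a # w))) / d n \<le> ?y n) U"
      using d_nonneg by (intro always_eventually allI) (simp add: divide_right_mono flip: add_divide_distrib)
    show "0 \<le> nrm (?E n (a # w) - rho n (cls R (a # w))) / d n" for n
      using c d_nonneg nrm_nonneg[of "?E n (a # w) - rho n (cls R (a # w))" "k n"] by simp
  qed
qed

lemma almost_hom_relator:
  assumes "r \<in> R"
  shows "((\<lambda>n. nrm (eval_word (k n) (\<lambda>s. rho n (cls R [(s, True)])) r - 1\<^sub>m (k n)) / d n) \<longlongrightarrow> 0) U"
proof (rule tendsto_zero_squeeze)
  let ?E = "\<lambda>n. eval_word (k n) (\<lambda>s. rho n (cls R [(s, True)])) r"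
  have "cls R r = cls R []"
    unfolding cls_eq_iff using pres_eq.relator[OF assms, of "[]" "[]"] by simp
  then have "((\<lambda>n. nrm (?E n - rho n (cls R [])) / d n) \<longlongrightarrow> 0) U"
    using almost_hom_eval_word[of r] by simp
  then show "((\<lambda>n. nrm (?E n - rho n (cls R [])) / d n + nrm (rho n (cls R []) - 1\<^sub>m (k n)) / d n) \<longlongrightarrow> 0) U"
    using almost_hom_unit by (rule tendsto_add_zero)
  have E: "?E n \<in> carrier_mat (k n) (k n)" for n
    by (rule unitary_matD(1)[OF unitary_eval_word]) (simp add: rho_unitary)
  have "nrm (?E n - 1\<^sub>m (k n)) \<le> nrm (?E n - rho n (cls R [])) + nrm (rho n (cls R []) - 1\<^sub>m (k n))" for n
    using E rho_carrier[OF cls_in_Gamma] by (intro nrm_triangle[of _ "k n"]) auto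
  then show "eventually (\<lambda>n. nrm (?E n - 1\<^sub>m (k n)) / d n
      \<le> nrm (?E n - rho n (cls R [])) / d n + nrm (rho n (cls R []) - 1\<^sub>m (k n)) / d n) U"
    using d_nonneg by (intro always_eventually allI) (simp add: divide_right_mono flip: add_divide_distrib)
  show "0 \<le> nrm (?E n - 1\<^sub>m (k n)) / d n" for n
    using E d_nonneg nrm_nonneg[of "?E n - 1\<^sub>m (k n)" "k n"] by simp
qed

end

end

subsection \<open>Improving the asymptotic representation\<close>

text \<open>This bounds how far the correction moves a lift. Since \<open>d \<le> 1\<close>, the
  quadratic error \<open>d^2 * M^2\<close> is absorbed into \<open>d * M^2\<close>.\<close>

lemma (in admissible) nrm_minus_one_le:
  assumes C: "C \<in> carrier_mat k k" and b: "b \<in> carrier_mat k k" "nrm b \<le> M"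
    and nC: "nrm (C - (1\<^sub>m k - complex_of_real d \<cdot>\<^sub>m skew_part b)) \<le> d\<^sup>2 * M\<^sup>2"
    and d: "0 \<le> d" "d \<le> 1"
  shows "nrm (C - 1\<^sub>m k) \<le> (M + M\<^sup>2) * d"
proof -
  let ?S = "complex_of_real d \<cdot>\<^sub>m skew_part b"
  have eq: "C - 1\<^sub>m k = (C - (1\<^sub>m k - ?S)) - ?S"
  proof -
    have "C - 1\<^sub>m k = (C - (1\<^sub>m k - S)) - S" if "S \<in> carrier_mat k k" for S
      using C that by (intro eq_matI) auto
    from this[of ?S] show ?thesis using b by simp
  qed
  have "nrm (C - 1\<^sub>m k) \<le> nrm (C - (1\<^sub>m k - ?S)) + nrm ?S"
    by (subst eq) (rule nrm_minus_le[of _ k]; use C b in simp)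
  also have "nrm ?S \<le> d * M"
    using nrm_skew_part_le[OF b(1)] b d by (simp add: nrm_smult[of _ k] mult_left_mono)
  finally have "nrm (C - 1\<^sub>m k) \<le> d\<^sup>2 * M\<^sup>2 + d * M" using nC by simp
  also have "d\<^sup>2 * M\<^sup>2 \<le> d * M\<^sup>2"
    using d by (intro mult_right_mono) (auto simp: power2_eq_square mult_left_le)
  finally show ?thesis by (simp add: algebra_simps)
qed

text \<open>The maximum over the finite set of relators is dominated by the sum, which turns limits
  for single relators into one for the defect.\<close>

lemma defect_tendsto_zero_over:
  assumes R: "finite R" and nn: "\<And>n r. r \<in> R \<Longrightarrow> nrm (eval_word (k n) (f n) r - 1\<^sub>m (k n)) \<ge> 0"
    and d: "\<And>n. d n \<ge> 0"
    and lim: "\<And>r. r \<in> R \<Longrightarrow> ((\<lambda>n. nrm (eval_word (k n) (f n) r - 1\<^sub>m (k n)) / d n) \<longlongrightarrow> 0) U"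
  shows "((\<lambda>n. defect nrm R (k n) (f n) / d n) \<longlongrightarrow> 0) U"
proof (rule tendsto_zero_squeeze)
  let ?x = "\<lambda>r n. nrm (eval_word (k n) (f n) r - 1\<^sub>m (k n))"
  show "((\<lambda>n. \<Sum>r\<in>R. ?x r n / d n) \<longlongrightarrow> 0) U" by (intro tendsto_null_sum lim)
  have "defect nrm R (k n) (f n) \<le> (\<Sum>r\<in>R. ?x r n)" for n
    unfolding defect_def using R nn by (auto intro!: Max.boundedI sum_nonneg member_le_sum)
  then show "eventually (\<lambda>n. defect nrm R (k n) (f n) / d n \<le> (\<Sum>r\<in>R. ?x r n / d n)) U"
    using d by (intro always_eventually allI) (simp add: divide_right_mono flip: sum_divide_distrib)
qed (use R d in \<open>simp add: defect_nonneg\<close>)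

theorem theorem3p6:
  fixes U :: "nat filter"
    and nrm :: "complex mat \<Rightarrow> real"
    and R :: "('s::finite) word set"
    and k :: "nat \<Rightarrow> nat"
    and phi :: "nat \<Rightarrow> 's \<Rightarrow> complex mat"
    and sigma :: "'s word set \<Rightarrow> 's word"
    and psi :: "nat \<Rightarrow> 's word set \<Rightarrow> complex mat"
  assumes U: "nonprincipal_ultrafilter U"
    and R_fin: "finite R"
    and norm: "admissible_norm nrm"
    and phi_unitary: "\<And>n s. unitary_mat (k n) (phi n s)"
    and phi_asym: "((\<lambda>n. defect nrm R (k n) (phi n)) \<longlongrightarrow> 0) U"
    and sigma_section: "\<And>g. g \<in> Gamma R \<Longrightarrow> sigma g \<in> g"
    and psi_unitary: "\<And>n g. g \<in> Gamma R \<Longrightarrow> unitary_mat (k n) (psi n g)"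
    and psi_unit: "\<And>n. psi n (gunit R) = 1\<^sub>m (k n)"
    and psi_inv: "\<And>n g. g \<in> Gamma R \<Longrightarrow> psi n (ginv R g) = mat_adjoint (psi n g)"
    and psi_close: "\<And>g. g \<in> Gamma R \<Longrightarrow>
          bigO_U U (\<lambda>n. nrm (eval_word (k n) (phi n) (sigma g) - psi n g))
                   (\<lambda>n. defect nrm R (k n) (phi n))"
    and trivial: "\<exists>beta :: 's word set \<Rightarrow> nat \<Rightarrow> complex mat.
          (\<forall>g \<in> Gamma R. \<forall>n. beta g n \<in> carrier_mat (k n) (k n)) \<and>
          (\<forall>g \<in> Gamma R. \<exists>C. \<forall>n. nrm (beta g n) \<le> C) \<and>
          (\<forall>g \<in> Gamma R. \<forall>h \<in> Gamma R.
             ((\<lambda>n. nrm (cocyc_alpha nrm R k phi sigma psi g h n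
                 - (eval_word (k n) (phi n) (sigma g) * beta h n
                      * mat_adjoint (eval_word (k n) (phi n) (sigma g))
                    - beta (gmul R g h) n + beta g n))) \<longlongrightarrow> 0) U)"
  shows "\<exists>phi' :: nat \<Rightarrow> 's \<Rightarrow> complex mat.
           (\<forall>n s. unitary_mat (k n) (phi' n s)) \<and>
           ((\<lambda>n. defect nrm R (k n) (phi' n)) \<longlongrightarrow> 0) U \<and>
           bigO_U U (\<lambda>n. Max (range (\<lambda>s. nrm (phi n s - phi' n s))))
                    (\<lambda>n. defect nrm R (k n) (phi n)) \<and>
           littleo_U U (\<lambda>n. defect nrm R (k n) (phi' n))
                       (\<lambda>n. defect nrm R (k n) (phi n))"
proof -
  interpret admissible nrm by standard (rule norm)
  define d where "d n = defect nrm R (k n) (phi n)" for n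
  have d0: "d n \<ge> 0" for n using defect_nonneg[OF R_fin] by (simp add: d_def)
  have dlim: "(d \<longlongrightarrow> 0) U" using phi_asym by (simp add: d_def[abs_def])
  obtain beta where beta_carrier: "\<And>g n. g \<in> Gamma R \<Longrightarrow> beta g n \<in> carrier_mat (k n) (k n)"
    and beta_bdd: "\<And>g. g \<in> Gamma R \<Longrightarrow> \<exists>C. \<forall>n. nrm (beta g n) \<le> C"
    and beta_lim: "\<And>g h. g \<in> Gamma R \<Longrightarrow> h \<in> Gamma R \<Longrightarrow>
             ((\<lambda>n. nrm (cocyc_alpha nrm R k phi sigma psi g h n
                 - (eval_word (k n) (phi n) (sigma g) * beta h n
                      * mat_adjoint (eval_word (k n) (phi n) (sigma g))
                    - beta (gmul R g h) n + beta g n))) \<longlongrightarrow> 0) U"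
    using trivial by blast
  \<comment> \<open>\<open>d n\<close> is real, so the scaled matrix stays skew-adjoint and the
    Cayley estimate applies; its quadratic error becomes \<open>O(d^2)\<close>.\<close>
  have ex: "\<exists>C. unitary_mat (k n) C \<and>
      nrm (C - (1\<^sub>m (k n) - complex_of_real (d n) \<cdot>\<^sub>m skew_part (beta g n))) \<le> (d n)\<^sup>2 * (nrm (beta g n))\<^sup>2"
    if g: "g \<in> Gamma R" for g n
  proof -
    let ?S = "skew_part (beta g n)" and ?X = "complex_of_real (d n) \<cdot>\<^sub>m skew_part (beta g n)"
    have S: "?S \<in> carrier_mat (k n) (k n)" using beta_carrier[OF g] by simp
    have "mat_adjoint ?X = - ?X"
      using beta_carrier[OF g, of n] by (simp add: mat_adjoint_smult) (auto intro!: eq_matI)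
    then obtain C where C: "unitary_mat (k n) C" "nrm (C - (1\<^sub>m (k n) - ?X)) \<le> (nrm ?X)\<^sup>2 / 2"
      using ex_unitary_near_one[of ?X "k n"] S by auto
    have "nrm ?X = d n * nrm ?S" using S d0 by (simp add: nrm_smult[of _ "k n"])
    also have "\<dots> \<le> d n * nrm (beta g n)"
      using nrm_skew_part_le[OF beta_carrier[OF g]] d0 by (simp add: mult_left_mono)
    finally have "(nrm ?X)\<^sup>2 \<le> (d n)\<^sup>2 * (nrm (beta g n))\<^sup>2"
      using nrm_nonneg[of ?X "k n"] S power_mono[of "nrm ?X" "d n * nrm (beta g n)" 2]
      by (simp add: power_mult_distrib)
    then show ?thesis using C zero_le_power2[of "nrm ?X"] by (intro exI[of _ C]) linarith
  qed
  define Cay where "Cay n g = (SOME C. unitary_mat (k n) C \<and>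
      nrm (C - (1\<^sub>m (k n) - complex_of_real (d n) \<cdot>\<^sub>m skew_part (beta g n))) \<le> (d n)\<^sup>2 * (nrm (beta g n))\<^sup>2)"
    for n g
  have Cay_unitary: "unitary_mat (k n) (Cay n g)"
    and Cay_near: "nrm (Cay n g - (1\<^sub>m (k n) - complex_of_real (d n) \<cdot>\<^sub>m skew_part (beta g n)))
      \<le> (d n)\<^sup>2 * (nrm (beta g n))\<^sup>2" if "g \<in> Gamma R" for g n
    using someI_ex[OF ex[OF that, of n]] unfolding Cay_def by auto
  have Cay_near': "nrm (Cay n g - (1\<^sub>m (k n) - complex_of_real (d n) \<cdot>\<^sub>m skew_part (beta g n)))
      \<le> (d n)\<^sup>2 * M\<^sup>2" if "g \<in> Gamma R" "nrm (beta g n) \<le> M" for g n M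
    using Cay_near[OF that(1), of n] that(2) nrm_nonneg[OF beta_carrier[OF that(1)], of n]
      mult_left_mono[of "(nrm (beta g n))\<^sup>2" "M\<^sup>2" "(d n)\<^sup>2"]
    by (smt (verit) power_mono zero_le_power2)
  define rho where "rho n g = Cay n g * psi n g" for n g
  have rho_unitary: "unitary_mat (k n) (rho n g)" if "g \<in> Gamma R" for g n
    using that by (simp add: rho_def Cay_unitary psi_unitary)
  let ?e = "\<lambda>g n. eval_word (k n) (phi n) (sigma g)"
  have e_unitary: "unitary_mat (k n) (?e g n)" for g n
    by (rule unitary_eval_word) (rule phi_unitary)
  have e_psi: "((\<lambda>n. nrm (?e g n - psi n g)) \<longlongrightarrow> 0) U" if g: "g \<in> Gamma R" for g
  proof -
    obtain C where C: "eventually (\<lambda>n. nrm (?e g n - psi n g) \<le> C * d n) U"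
      using psi_close[OF g] by (auto simp: bigO_U_def d_def)
    have "((\<lambda>n. C * d n) \<longlongrightarrow> 0) U" using dlim by (rule tendsto_mult_right_zero)
    then show ?thesis
    proof (rule tendsto_zero_squeeze[OF _ _ C])
      show "0 \<le> nrm (?e g n - psi n g)" for n
        using unitary_matD(1)[OF psi_unitary[OF g]] by (intro nrm_nonneg[of _ "k n"]) simp
    qed
  qed

  have rho_mult: "((\<lambda>n. nrm (rho n g * rho n h - rho n (gmul R g h)) / d n) \<longlongrightarrow> 0) U"
    if g: "g \<in> Gamma R" and h: "h \<in> Gamma R" for g h
  proof -
    let ?gh = "gmul R g h"
    have gh: "?gh \<in> Gamma R" by simp
    obtain M1 M2 M3 where Ms: "\<And>n. nrm (beta g n) \<le> M1" "\<And>n. nrm (beta h n) \<le> M2"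
      "\<And>n. nrm (beta ?gh n) \<le> M3" using beta_bdd g h gh by meson
    \<comment> \<open>One bound for the three values of the cochain involved; it may depend on
      \<open>g\<close> and \<open>h\<close>.\<close>
    define M where "M = max M1 (max M2 M3)"
    have nb: "nrm (beta g n) \<le> M" "nrm (beta h n) \<le> M" "nrm (beta ?gh n) \<le> M" for n
      using Ms[of n] by (auto simp: M_def)
    define \<delta> where "\<delta> n = nrm (cocyc_alpha nrm R k phi sigma psi g h n
        - (?e g n * beta h n * mat_adjoint (?e g n) - beta ?gh n + beta g n))" for n
    define e1 where "e1 n = nrm (?e g n - psi n g)" for n
    define e2 where "e2 n = nrm (?e ?gh n - psi n ?gh)" for n
    define \<kappa> where "\<kappa> n = \<delta> n + 3 * M" for n
    define \<mu> where "\<mu> n = M + d n * M\<^sup>2" for n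
    \<comment> \<open>The bracket of \<open>coboundary_correction\<close> at index \<open>n\<close>.
      Every summand contains one of the null sequences \<open>d\<close>, \<open>\<delta>\<close>,
      \<open>e1\<close>, \<open>e2\<close>, and the other factors converge.\<close>
    define B where "B n = d n * (\<mu> n * (\<mu> n + \<kappa> n) + \<mu> n * \<kappa> n + 3 * M\<^sup>2 + (\<kappa> n)\<^sup>2 / 2)
      + \<kappa> n * e2 n + \<delta> n + 2 * M * e1 n" for n
    have lims: "(\<delta> \<longlongrightarrow> 0) U" "(e1 \<longlongrightarrow> 0) U" "(e2 \<longlongrightarrow> 0) U"
      using beta_lim[OF g h] e_psi[OF g] e_psi[OF gh]
      by (simp_all add: \<delta>_def[abs_def] e1_def[abs_def] e2_def[abs_def])
    have "(\<kappa> \<longlongrightarrow> 0 + 3 * M) U" unfolding \<kappa>_def[abs_def] by (intro tendsto_intros lims)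
    moreover have "(\<mu> \<longlongrightarrow> M + 0 * M\<^sup>2) U" unfolding \<mu>_def[abs_def] by (intro tendsto_intros dlim)
    ultimately have "(B \<longlongrightarrow> 0) U"
      unfolding B_def[abs_def] by (auto intro!: tendsto_eq_intros lims dlim)
    \<comment> \<open>With the absolute value the bound also covers \<open>d n = 0\<close>, where
      the quotient is 0 by convention, without a discussion of the sign of
      \<open>B n\<close>.\<close>
    then have Blim: "((\<lambda>n. \<bar>B n\<bar>) \<longlongrightarrow> 0) U" by (rule tendsto_rabs_zero)
    have "nrm (rho n g * rho n h - rho n ?gh) / d n \<le> \<bar>B n\<bar>" for n
    proof (cases "d n = 0")
      case False
      then have d: "d n > 0" using d0[of n] by simp
      have "\<delta> n = nrm ((1 / complex_of_real (d n)) \<cdot>\<^sub>m (psi n g * psi n h - psi n ?gh) * mat_adjoint (?e ?gh n)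
                 - (?e g n * beta h n * mat_adjoint (?e g n) - beta ?gh n + beta g n))"
        using d by (simp add: \<delta>_def cocyc_alpha_def cocyc_c_def d_def)
      note cc = coboundary_correction[OF psi_unitary[OF g] psi_unitary[OF h] psi_unitary[OF gh]
          e_unitary e_unitary Cay_unitary[OF g] Cay_unitary[OF h] Cay_unitary[OF gh]
          beta_carrier[OF g] beta_carrier[OF h] beta_carrier[OF gh] nb d
          Cay_near'[OF g nb(1)] Cay_near'[OF h nb(2)] Cay_near'[OF gh nb(3)]
          this e1_def e2_def \<kappa>_def \<mu>_def]
      have "nrm (rho n g * rho n h - rho n ?gh) \<le> d n * B n"
        using cc unfolding rho_def B_def .
      also have "\<dots> \<le> d n * \<bar>B n\<bar>" using d by simp
      finally show ?thesis using d by (simp add: field_simps)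
    qed simp
    then show ?thesis
    proof (intro tendsto_zero_squeeze[OF Blim] always_eventually allI)
      fix n
      have "rho n g * rho n h - rho n ?gh \<in> carrier_mat (k n) (k n)"
        using unitary_matD(1)[OF rho_unitary] g h gh by simp
      then show "0 \<le> nrm (rho n g * rho n h - rho n ?gh) / d n"
        using d0 nrm_nonneg by simp
    qed
  qed

  \<comment> \<open>Estimates in terms of \<open>_ / d n\<close> are void where \<open>d n = 0\<close>; there \<open>phi\<close> itself is already exact.\<close>
  define phi' where "phi' n s = (if d n = 0 then phi n s else rho n (cls R [(s, True)]))" for n s
  have phi'_unitary: "unitary_mat (k n) (phi' n s)" for n s
    by (simp add: phi'_def phi_unitary rho_unitary)
  define x where "x n = defect nrm R (k n) (phi' n)" for n
  have x_null: "x n = 0" if "d n = 0" for n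
  proof -
    have "phi' n = phi n" using that by (auto simp: phi'_def)
    then show ?thesis using that by (simp add: x_def d_def)
  qed
  have lim: "((\<lambda>n. x n / d n) \<longlongrightarrow> 0) U"
    unfolding x_def
  proof (rule defect_tendsto_zero_over[OF R_fin])
    fix r assume "r \<in> R"
    have "nrm (eval_word (k n) (phi' n) r - 1\<^sub>m (k n)) / d n
      = nrm (eval_word (k n) (\<lambda>s. rho n (cls R [(s, True)])) r - 1\<^sub>m (k n)) / d n" for n
      by (cases "d n = 0") (simp_all add: phi'_def[abs_def])
    then show "((\<lambda>n. nrm (eval_word (k n) (phi' n) r - 1\<^sub>m (k n)) / d n) \<longlongrightarrow> 0) U"
      using almost_hom_relator[OF d0 rho_unitary rho_mult \<open>r \<in> R\<close>] by (simp only:)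
  next
    fix n r
    show "0 \<le> nrm (eval_word (k n) (phi' n) r - 1\<^sub>m (k n))"
      using unitary_matD(1)[OF unitary_eval_word[OF phi'_unitary]] by (intro nrm_nonneg[of _ "k n"]) simp
  qed (rule d0)
  \<comment> \<open>\<open>littleo_U\<close> asks for the factorisation at every index, including
    those with \<open>d n = 0\<close>, where it holds because \<open>x n\<close> vanishes as
    well.\<close>
  have eq: "x n = x n / d n * d n" for n using x_null[of n] by simp
  have little: "littleo_U U x d"
    unfolding littleo_U_def
  proof (intro exI[of _ "\<lambda>n. x n / d n"] conjI allI)
    show "0 \<le> x n / d n" for n using d0 defect_nonneg[OF R_fin] by (simp add: x_def)
  qed (use lim eq in auto)
  have "((\<lambda>n. x n / d n * d n) \<longlongrightarrow> 0) U" by (rule tendsto_mult_zero[OF lim dlim])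
  then have asym: "(x \<longlongrightarrow> 0) U" using eq by simp

  \<comment> \<open>Three moves lead from \<open>phi n s\<close> to \<open>rho n g\<close>:
    \<open>C1\<close> for passing to the word chosen by the section, \<open>C2\<close> for passing
    to the lift, and \<open>M + M^2\<close> for the Cayley correction.\<close>
  have "\<exists>C. eventually (\<lambda>n. nrm (phi n s - phi' n s) \<le> C * d n) U" for s
  proof -
    define g where "g = cls R [(s, True)]"
    have g: "g \<in> Gamma R" by (simp add: g_def)
    have "pres_eq R [(s, True)] (sigma g)" using sigma_section[OF g] by (simp add: g_def cls_def)
    from pres_eq_imp_eval_word_close[OF this R_fin] obtain C1 where
      C1: "\<And>n. nrm (phi n s - ?e g n) \<le> C1 * d n"
      using phi_unitary by (metis (no_types, lifting) d_def eval_word_singleton)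
    obtain C2 where C2: "eventually (\<lambda>n. nrm (?e g n - psi n g) \<le> C2 * d n) U"
      using psi_close[OF g] by (auto simp: bigO_U_def d_def)
    obtain M where M: "\<And>n. nrm (beta g n) \<le> M" using beta_bdd[OF g] by blast
    have "eventually (\<lambda>n. d n < 1) U" by (rule order_tendstoD(2)[OF dlim]) simp
    with C2 have "eventually (\<lambda>n. nrm (phi n s - phi' n s) \<le> (C1 + C2 + (M + M\<^sup>2)) * d n) U"
    proof eventually_elim
      case (elim n)
      note c = unitary_matD(1)[OF phi_unitary[of n s]] unitary_matD(1)[OF e_unitary[of n g]]
        unitary_matD(1)[OF psi_unitary[OF g, of n]] unitary_matD(1)[OF rho_unitary[OF g, of n]]
        unitary_matD(1)[OF Cay_unitary[OF g, of n]]
      show ?case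
      proof (cases "d n = 0")
        case True
        then show ?thesis using nrm_minus_self[OF c(1)] by (simp add: phi'_def)
      next
        case False
        have "psi n g - rho n g = (1\<^sub>m (k n) - Cay n g) * psi n g"
          using c by (simp add: rho_def minus_mult_distrib_mat[of _ "k n" "k n" _ _ "k n"])
        then have "nrm (psi n g - rho n g) = nrm (Cay n g - 1\<^sub>m (k n))"
          using nrm_unitary_right[of "1\<^sub>m (k n) - Cay n g" "k n" "psi n g"] c psi_unitary[OF g]
            nrm_minus_commute[of "1\<^sub>m (k n)" "k n" "Cay n g"] by simp
        also have "\<dots> \<le> (M + M\<^sup>2) * d n"
          using c(5) beta_carrier[OF g] M Cay_near'[OF g M] d0 elim
          by (intro nrm_minus_one_le[of _ _ "beta g n"]) auto
        finally have 3: "nrm (psi n g - rho n g) \<le> (M + M\<^sup>2) * d n" .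
        have "nrm (phi n s - rho n g) \<le> nrm (phi n s - ?e g n) + nrm (?e g n - rho n g)"
          using c by (intro nrm_triangle[of _ "k n"]) auto
        moreover have "nrm (?e g n - rho n g) \<le> nrm (?e g n - psi n g) + nrm (psi n g - rho n g)"
          using c by (intro nrm_triangle[of _ "k n"]) auto
        ultimately have "nrm (phi n s - rho n g) \<le> (C1 + C2 + (M + M\<^sup>2)) * d n"
          using C1[of n] elim(1) 3 by (simp add: distrib_right)
        then show ?thesis using False by (simp add: phi'_def g_def)
      qed
    qed
    then show ?thesis by blast
  qed
  then obtain C where C: "\<And>s. eventually (\<lambda>n. nrm (phi n s - phi' n s) \<le> C s * d n) U" by metis
  have gens: "eventually (\<lambda>n. \<forall>s. nrm (phi n s - phi' n s) \<le> C s * d n) U"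
    by (rule eventually_all_finite) (rule C)
  have "eventually (\<lambda>n. Max (range (\<lambda>s. nrm (phi n s - phi' n s))) \<le> Max (range C) * d n) U"
    using gens
  proof eventually_elim
    case (elim n)
    have "C s * d n \<le> Max (range C) * d n" for s using d0 by (intro mult_right_mono) auto
    then show ?case using elim by (auto intro!: Max.boundedI intro: order_trans)
  qed
  then have "bigO_U U (\<lambda>n. Max (range (\<lambda>s. nrm (phi n s - phi' n s)))) d"
    unfolding bigO_U_def by blast
  then show ?thesis
    using phi'_unitary asym little unfolding x_def[abs_def] d_def[abs_def] by blast
qed

end
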